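(* Assume (A1), (A2), (A3) and (A4) (stated in the context), and let $q,\psi_0$ and the core sequence $\{\overline S_t\}$ with levels $\{\overline\nu_m\}$ be as in the context. For $n\ge0$ let $\overline B_n:=\bigcup_{m=0}^n\{\overline\nu_m=n\}$. Then for every $n\ge0$, $$\mathbf P_*(B_n)=\psi_0\,q^n\,\mathbf P(\overline B_n),$$ and for all integers $n\ge k\ge0$ and every $A\subset(\mathbb Z^d)^{k+1}$, $$\mathbf P_*\big((S_0,\dots,S_k)\in A,\ B_n\big)=\sum_{m=0}^n\mathbf P_*\big((S_0,\dots,S_k)\in A,\ \eta_*(n)=m\big)=\sum_{m=0}^n\psi_0q^n\,\mathbf P\big((\overline S_0,\dots,\overline S_k)\in A,\ \overline\nu_m=n\big)=\psi_0\,q^n\,\mathbf P\big((\overline S_0,\dots,\overline S_k)\in A,\ \overline B_n\big),$$ $$\mathbf P_*\big((S_0,\dots,S_k)\in A\,\big|\,B_n\big)=\mathbf P\big((\overline S_0,\dots,\overline S_k)\in A\,\big|\,\overline B_n\big).$$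
   Context: Conventions: $\inf\emptyset=\infty$, $\sup\emptyset=-\infty$. Fix $d\ge1$; $x[1]$ is the first coordinate of $x\in\mathbb Z^d$; $\mathbb Z^d_{0+}=\{x\in\mathbb Z^d: x[1]\ge0\}$. Model. $S_t=S_0+\sum_{j=1}^t\xi_j$, $t\ge0$, is a random walk on $\mathbb Z^d$; $H(x)\in\{0,1,2,\dots\}\cup\{\infty\}$, $x\in\mathbb Z^d$, are random constraints. $L_t(x)=\sum_{j=0}^t\mathbf 1\{S_j=x\}$; $T_*=\inf\{t\ge0: L_t(S_t)>H(S_t)\}\le\infty$; $\alpha(n)=\inf\{t\ge0:S_t[1]\ge n\}\le\infty$; $B_n=\{\alpha(n)<T_*\}$ for $n\ge0$. $\mathbf P_*$ denotes the probability in this model. (A1) $\xi_1,\xi_2,\dots$ are i.i.d. $\mathbb Z^d$-valued, $\mathbf P(\xi_1[1]\le1)=1$ and $\mathbf P(\xi_1[1]=1)>0$. (A2) The three families $\{S_0;\,H(x),x\notin\mathbb Z^d_{0+}\}$, $\{\xi_i,i\ge1\}$, $\{H(x),x\in\mathbb Z^d_{0+}\}$ are mutually independent, $S_0[1]\le0$ a.s., and $\mathbf P_*(B_0)>0$. (A3) $\{H(x),x\in\mathbb Z^d_{0+}\}$ are i.i.d. with $\mathbf P(1\le H(0)\le\infty)=1$. (A4) Let $\beta_0=\inf\{t>0:\xi_1[1]+\dots+\xi_t[1]=0\}$ and $\beta_{0,0}=\inf\{t>0:\xi_1+\dots+\xi_t=0\}$. If $\mathbf P(\beta_0<\infty)=1$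 then $\mathbf P(\beta_{0,0}<\infty)>0$; and if $\mathbf P(\beta_0=\beta_{0,0}<\infty)=1$ then $\mathbf E H(0)<\infty$. $\mathbf P_0$ denotes the probability in the same model (same laws of $\{\xi_i\}$ and of $\{H(x),x\in\mathbb Z^d_{0+}\}$) but with $S_0=0$ and $H(y)=0$ for all $y\notin\mathbb Z^d_{0+}$. Separating levels. If $\alpha(n)<\infty$, $k\in\{0,\dots,n\}$ is an $n$-separating level if $\sup_{0\le t<\alpha(k)}S_t[1]<k=S_{\alpha(k)}[1]\le\inf_{\alpha(k)<t<\alpha(n)}S_t[1]$. On $B_n$, $\eta_*(n)+1$ is the number of $n$-separating levels; off $B_n$, $\eta_*(n)=-1$. If $\eta_*(n)\ge1$, $\varkappa_*(n)$ is the largest $n$-separating level $k<n$; otherwise $\varkappa_*(n)=-\infty$. Constants. Under (A1)–(A4) it is known (an earlier theorem of the paper) that there is a (necessarily unique) $q\in(0,1]$ with $\sum_{k\ge1}\mathbf P_0(\varkappa_*(k)=0)/q^k=1$, and that then $1\le\mu:=\sum_{k\ge1}k\mathbf P_0(\varkappa_*(k)=0)/q^k<\infty$ and $0<\psi_0:=\sum_{m\ge0}\mathbf P_*(\eta_*(m)=0)/q^m<\infty$. Core sequence. On some probability space with probability $\mathbf P$, take mutually independent random blocks $(\overline\nu_0,\overline T_0,(\overline S_0,\dots,\overline S_{\overline T_0}))$ and $(\overline\lambda_i,\overline\tau_i,(\overline Y_{i,1},\dots,\overline Y_{i,\overline\tau_i}))$, $i\ge1$, the latter identically distributed, with laws: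 for integers $K\ge k\ge0$ and $\vec y\in(\mathbb Z^d)^{K+1}$, $$\mathbf P(\overline\nu_0=k,\overline T_0=K,(\overline S_0,\dots,\overline S_K)=\vec y)=\frac{\mathbf P_*(\alpha(k)=K<T_*,\,\eta_*(k)=0,\,(S_0,\dots,S_K)=\vec y)}{\psi_0q^k};$$ for integers $L\ge l\ge1$ and $\vec x\in(\mathbb Z^d)^L$, $$\mathbf P(\overline\lambda_i=l,\overline\tau_i=L,(\overline Y_{i,1},\dots,\overline Y_{i,L})=\vec x)=\frac{\mathbf P_0(\alpha(l)=L<T_*,\,\varkappa_*(l)=0,\,(S_1-S_0,\dots,S_L-S_0)=\vec x)}{q^l}.$$ Put $\overline\nu_m=\overline\nu_0+\sum_{i=1}^m\overline\lambda_i$, $\overline T_m=\overline T_0+\sum_{i=1}^m\overline\tau_i$, and define recursively $\overline S_{\overline T_{i-1}+j}=\overline S_{\overline T_{i-1}}+\overline Y_{i,j}$ for $1\le j\le\overline\tau_i$, $i\ge1$. The resulting $\{\overline S_t\}_{t\ge0}$ is the core sequence. *)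

theory Defs
  imports "HOL-Probability.Probability"
begin

text \<open>
  The lattice is \<open>int ^ 'd\<close> with \<open>d = CARD('d) \<ge> 1\<close>; a distinguished index \<open>e :: 'd\<close> plays the
  role of the first coordinate, so \<open>x $ e\<close> is x[1].

  All functionals of the constrained walk are defined pathwise, for a trajectory
  \<open>s :: nat \<Rightarrow> int ^ 'd\<close> and constraints \<open>h :: int ^ 'd \<Rightarrow> enat\<close>.  On the complete lattice
  \<open>enat\<close> the infimum of the empty set is \<open>\<infinity>\<close>.
\<close>

text \<open>The steps are \<open>x 1, x 2, \<dots>\<close>; the value \<open>x 0\<close> is never used.\<close>

definition walk :: "int ^ 'd \<Rightarrow> (nat \<Rightarrow> int ^ 'd) \<Rightarrow> nat \<Rightarrow> int ^ 'd" where
  "walk s0 x t = s0 + (\<Sum>j=1..t. x j)"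

definition local_time :: "(nat \<Rightarrow> int ^ 'd) \<Rightarrow> nat \<Rightarrow> int ^ 'd \<Rightarrow> nat" where
  "local_time s t x = (\<Sum>j=0..t. of_bool (s j = x))"

definition T_star :: "(nat \<Rightarrow> int ^ 'd) \<Rightarrow> (int ^ 'd \<Rightarrow> enat) \<Rightarrow> enat" where
  "T_star s h = Inf {enat t | t. enat (local_time s t (s t)) > h (s t)}"

definition alpha :: "'d \<Rightarrow> (nat \<Rightarrow> int ^ 'd) \<Rightarrow> nat \<Rightarrow> enat" where
  "alpha e s n = Inf {enat t | t. s t $ e \<ge> int n}"

definition event_B :: "'d \<Rightarrow> (nat \<Rightarrow> int ^ 'd) \<Rightarrow> (int ^ 'd \<Rightarrow> enat) \<Rightarrow> nat \<Rightarrow> bool" where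
  "event_B e s h n \<longleftrightarrow> alpha e s n < T_star s h"

text \<open>
  The supremum and infimum are taken in \<open>ereal\<close>, where they are \<open>-\<infinity>\<close> and \<open>\<infinity>\<close> on the empty set.
\<close>

definition separating :: "'d \<Rightarrow> (nat \<Rightarrow> int ^ 'd) \<Rightarrow> nat \<Rightarrow> nat \<Rightarrow> bool" where
  "separating e s n k \<longleftrightarrow> alpha e s n < \<infinity> \<and> k \<le> n \<and>
     (SUP t\<in>{t. enat t < alpha e s k}. ereal (real_of_int (s t $ e))) < ereal (real k) \<and>
     int k = s (the_enat (alpha e s k)) $ e \<and>
     ereal (real k) \<le>
       (INF t\<in>{t. alpha e s k < enat t \<and> enat t < alpha e s n}. ereal (real_of_int (s t $ e)))"

definition eta :: "'d \<Rightarrow> (nat \<Rightarrow> int ^ 'd) \<Rightarrow> (int ^ 'd \<Rightarrow> enat) \<Rightarrow> nat \<Rightarrow> int" where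
  "eta e s h n = (if event_B e s h n then int (card {k. separating e s n k}) - 1 else -1)"

definition kappa :: "'d \<Rightarrow> (nat \<Rightarrow> int ^ 'd) \<Rightarrow> (int ^ 'd \<Rightarrow> enat) \<Rightarrow> nat \<Rightarrow> ereal" where
  "kappa e s h n =
     (if eta e s h n \<ge> 1 then ereal (real (Max {k. separating e s n k \<and> k < n})) else -\<infinity>)"

definition beta0 :: "'d \<Rightarrow> (nat \<Rightarrow> int ^ 'd) \<Rightarrow> enat" where
  "beta0 e x = Inf {enat t | t. t > 0 \<and> (\<Sum>i=1..t. x i $ e) = 0}"

definition beta00 :: "(nat \<Rightarrow> int ^ 'd) \<Rightarrow> enat" where
  "beta00 x = Inf {enat t | t. t > 0 \<and> (\<Sum>i=1..t. x i) = 0}"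

text \<open>
  The model lives on a probability space \<open>M\<close>: a starting point \<open>S0\<close>, steps \<open>xi\<close>
  and constraints \<open>H\<close>.
\<close>

definition A1 :: "'w measure \<Rightarrow> 'd::finite \<Rightarrow> ('w \<Rightarrow> nat \<Rightarrow> int ^ 'd) \<Rightarrow> bool" where
  "A1 M e xi \<longleftrightarrow>
     prob_space.indep_vars M (\<lambda>_. count_space UNIV) (\<lambda>i w. xi w i) {1..} \<and>
     (\<forall>i\<ge>1. distr M (count_space UNIV) (\<lambda>w. xi w i) = distr M (count_space UNIV) (\<lambda>w. xi w 1)) \<and>
     \<P>(w in M. xi w 1 $ e \<le> 1) = 1 \<and>
     \<P>(w in M. xi w 1 $ e = 1) > 0"

text \<open>
  Mutual independence of the three families is that of the sigma-algebras they generate; it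
  includes the measurability of all variables involved.
\<close>

definition A2 :: "'w measure \<Rightarrow> 'd::finite \<Rightarrow> ('w \<Rightarrow> int ^ 'd) \<Rightarrow> ('w \<Rightarrow> nat \<Rightarrow> int ^ 'd) \<Rightarrow>
    ('w \<Rightarrow> int ^ 'd \<Rightarrow> enat) \<Rightarrow> bool" where
  "A2 M e S0 xi H \<longleftrightarrow>
     prob_space.indep_sets M
       (\<lambda>i::nat. sigma_sets (space M)
         ([{S0 -` A \<inter> space M | A. True} \<union>
             {(\<lambda>w. H w x) -` A \<inter> space M | x A. \<not> x $ e \<ge> 0},
           {(\<lambda>w. xi w i) -` A \<inter> space M | i A. i \<ge> 1},
           {(\<lambda>w. H w x) -` A \<inter> space M | x A. x $ e \<ge> 0}] ! i))
       {0, 1, 2} \<and>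
     (AE w in M. S0 w $ e \<le> 0) \<and>
     \<P>(w in M. event_B e (walk (S0 w) (xi w)) (H w) 0) > 0"

definition A3 :: "'w measure \<Rightarrow> 'd::finite \<Rightarrow> ('w \<Rightarrow> int ^ 'd \<Rightarrow> enat) \<Rightarrow> bool" where
  "A3 M e H \<longleftrightarrow>
     prob_space.indep_vars M (\<lambda>_. count_space UNIV) (\<lambda>x w. H w x) {x. x $ e \<ge> 0} \<and>
     (\<forall>x. x $ e \<ge> 0 \<longrightarrow>
        distr M (count_space UNIV) (\<lambda>w. H w x) = distr M (count_space UNIV) (\<lambda>w. H w 0)) \<and>
     \<P>(w in M. 1 \<le> H w 0) = 1"

definition A4 :: "'w measure \<Rightarrow> 'd::finite \<Rightarrow> ('w \<Rightarrow> nat \<Rightarrow> int ^ 'd) \<Rightarrow>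
    ('w \<Rightarrow> int ^ 'd \<Rightarrow> enat) \<Rightarrow> bool" where
  "A4 M e xi H \<longleftrightarrow>
     (\<P>(w in M. beta0 e (xi w) < \<infinity>) = 1 \<longrightarrow> \<P>(w in M. beta00 (xi w) < \<infinity>) > 0) \<and>
     (\<P>(w in M. beta0 e (xi w) = beta00 (xi w) \<and> beta00 (xi w) < \<infinity>) = 1 \<longrightarrow>
        (\<integral>\<^sup>+ w. ennreal_of_enat (H w 0) \<partial>M) < \<infinity>)"

text \<open>
  The law \<open>P\<^sub>0\<close> is realised on \<open>M\<close> itself: the joint law of the steps and of the constraints on the
  half-space is kept, the starting point is replaced by 0 and the constraints off the half-space
  by 0.
\<close>

definition half_space_constraint ::
    "'d::finite \<Rightarrow> (int ^ 'd \<Rightarrow> enat) \<Rightarrow> int ^ 'd \<Rightarrow> enat" where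
  "half_space_constraint e h y = (if y $ e \<ge> 0 then h y else 0)"

definition P0 :: "'w measure \<Rightarrow> 'd::finite \<Rightarrow> ('w \<Rightarrow> nat \<Rightarrow> int ^ 'd) \<Rightarrow>
    ('w \<Rightarrow> int ^ 'd \<Rightarrow> enat) \<Rightarrow>
    ((nat \<Rightarrow> int ^ 'd) \<Rightarrow> (int ^ 'd \<Rightarrow> enat) \<Rightarrow> bool) \<Rightarrow> real" where
  "P0 M e xi H E = \<P>(w in M. E (walk 0 (xi w)) (half_space_constraint e (H w)))"

definition is_q :: "'w measure \<Rightarrow> 'd::finite \<Rightarrow> ('w \<Rightarrow> nat \<Rightarrow> int ^ 'd) \<Rightarrow>
    ('w \<Rightarrow> int ^ 'd \<Rightarrow> enat) \<Rightarrow> real \<Rightarrow> bool" where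
  "is_q M e xi H q \<longleftrightarrow> 0 < q \<and> q \<le> 1 \<and>
     ((\<lambda>k. P0 M e xi H (\<lambda>s h. kappa e s h k = 0) / q ^ k) has_sum 1) {1..}"

text \<open>
  If the series diverged, \<open>infsum\<close> would return 0.  In that case no sequence as in
  \<open>core_sequence\<close> below exists, because \<open>initial_law\<close> would vanish identically.
\<close>

definition psi0 :: "'w measure \<Rightarrow> 'd::finite \<Rightarrow> ('w \<Rightarrow> int ^ 'd) \<Rightarrow> ('w \<Rightarrow> nat \<Rightarrow> int ^ 'd) \<Rightarrow>
    ('w \<Rightarrow> int ^ 'd \<Rightarrow> enat) \<Rightarrow> real \<Rightarrow> real" where
  "psi0 M e S0 xi H q =
     infsum (\<lambda>m. \<P>(w in M. eta e (walk (S0 w) (xi w)) (H w) m = 0) / q ^ m) UNIV"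

text \<open>
  A block (level increment, duration, path).  The block with index 0 is
  \<open>(\<nu>\<^sub>0, T\<^sub>0, [S\<^sub>0, \<dots>, S\<^bsub>T\<^sub>0\<^esub>])\<close>, those with index \<open>i \<ge> 1\<close> are
  \<open>(\<lambda>\<^sub>i, \<tau>\<^sub>i, [Y\<^bsub>i,1\<^esub>, \<dots>, Y\<^bsub>i,\<tau>\<^sub>i\<^esub>])\<close>, where \<open>Y\<^bsub>i,j\<^esub>\<close> is the displacement since the
  start of the block.  The two laws below are point masses on blocks; triples that are not of
  the right shape have mass 0.
\<close>

type_synonym 'd block = "nat \<times> nat \<times> (int ^ 'd) list"

definition initial_law :: "'w measure \<Rightarrow> 'd::finite \<Rightarrow> ('w \<Rightarrow> int ^ 'd) \<Rightarrow>
    ('w \<Rightarrow> nat \<Rightarrow> int ^ 'd) \<Rightarrow> ('w \<Rightarrow> int ^ 'd \<Rightarrow> enat) \<Rightarrow> real \<Rightarrow> 'd block \<Rightarrow> real" where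
  "initial_law M e S0 xi H q = (\<lambda>(k, K, ys).
     if k \<le> K \<and> length ys = K + 1
     then \<P>(w in M. alpha e (walk (S0 w) (xi w)) k = enat K \<and>
            enat K < T_star (walk (S0 w) (xi w)) (H w) \<and>
            eta e (walk (S0 w) (xi w)) (H w) k = 0 \<and>
            map (walk (S0 w) (xi w)) [0..<K + 1] = ys)
          / (psi0 M e S0 xi H q * q ^ k)
     else 0)"

definition renewal_law :: "'w measure \<Rightarrow> 'd::finite \<Rightarrow> ('w \<Rightarrow> nat \<Rightarrow> int ^ 'd) \<Rightarrow>
    ('w \<Rightarrow> int ^ 'd \<Rightarrow> enat) \<Rightarrow> real \<Rightarrow> 'd block \<Rightarrow> real" where
  "renewal_law M e xi H q = (\<lambda>(l, L, xs).
     if 1 \<le> l \<and> l \<le> L \<and> length xs = L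
     then P0 M e xi H (\<lambda>s h. alpha e s l = enat L \<and> enat L < T_star s h \<and> kappa e s h l = 0 \<and>
            map (\<lambda>j. s j - s 0) [1..<L + 1] = xs)
          / q ^ l
     else 0)"

definition block_level :: "(nat \<Rightarrow> 'd block) \<Rightarrow> nat \<Rightarrow> nat" where
  "block_level b m = (\<Sum>i=0..m. fst (b i))"

definition block_time :: "(nat \<Rightarrow> 'd block) \<Rightarrow> nat \<Rightarrow> nat" where
  "block_time b m = (\<Sum>i=0..m. fst (snd (b i)))"

definition block_path :: "(nat \<Rightarrow> 'd block) \<Rightarrow> nat \<Rightarrow> (int ^ 'd) list" where
  "block_path b i = snd (snd (b i))"

definition event_Bbar :: "(nat \<Rightarrow> 'd block) \<Rightarrow> nat \<Rightarrow> bool" where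
  "event_Bbar b n \<longleftrightarrow> (\<exists>m\<in>{0..n}. block_level b m = n)"

text \<open>
  The recursion is required almost surely; since almost surely all durations of blocks
  with \<open>i \<ge> 1\<close> are positive, it determines \<open>S t\<close> for every \<open>t\<close> up to a null set.
\<close>

definition core_sequence :: "'w measure \<Rightarrow> 'd::finite \<Rightarrow> ('w \<Rightarrow> int ^ 'd) \<Rightarrow>
    ('w \<Rightarrow> nat \<Rightarrow> int ^ 'd) \<Rightarrow> ('w \<Rightarrow> int ^ 'd \<Rightarrow> enat) \<Rightarrow> real \<Rightarrow>
    'v measure \<Rightarrow> ('v \<Rightarrow> nat \<Rightarrow> 'd block) \<Rightarrow> ('v \<Rightarrow> nat \<Rightarrow> int ^ 'd) \<Rightarrow> bool" where
  "core_sequence M e S0 xi H q N blk S \<longleftrightarrow>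
     prob_space.indep_vars N (\<lambda>_. count_space UNIV) (\<lambda>i v. blk v i) UNIV \<and>
     (\<forall>b. \<P>(v in N. blk v 0 = b) = initial_law M e S0 xi H q b) \<and>
     (\<forall>i\<ge>1. \<forall>b. \<P>(v in N. blk v i = b) = renewal_law M e xi H q b) \<and>
     (\<forall>t. (\<lambda>v. S v t) \<in> N \<rightarrow>\<^sub>M count_space UNIV) \<and>
     (AE v in N.
        (\<forall>j\<in>{0..block_time (blk v) 0}. S v j = block_path (blk v) 0 ! j) \<and>
        (\<forall>i\<ge>1. \<forall>j\<in>{1..fst (snd (blk v i))}.
           S v (block_time (blk v) (i - 1) + j) = S v (block_time (blk v) (i - 1)) + block_path (blk v) i ! (j - 1)))"

end

theory Submission
  imports Defs
begin

text \<open>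
  A separating level cuts the path at a time after which it never goes below the level reached,
  while before it the path is strictly below.  So the two parts visit disjoint sets of sites, apart
  from the cut point, and the probability of following a given path within the constraints is the
  product of the probabilities of its parts.  Cutting a path with \<open>\<eta>\<^sub>*(n) = m\<close> at its largest separating
  level below \<open>n\<close> therefore gives for \<open>P\<^sub>*\<close> the same recursion in \<open>m\<close> as independence of the blocks
  gives for the core sequence; the factors \<open>q\<^bsup>-l\<^esup>\<close> of the blocks multiply to \<open>q\<^bsup>-n\<^esup>\<close>.  Summing over
  the countably many paths yields the result.
\<close>

subsection \<open>Separating levels of a path\<close>

text \<open>Levels, times and survival are functionals of a random trajectory, while the model only
  supplies independence of three families of variables. Neither stopping times nor a Markov property
  are invoked: a deterministic path \<open>y\<close> is fixed, and following it up to time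
  \<open>K\<close> within the constraints is a conjunction of a condition on the start, one on each
  step and one on each visited site. The factor of a site in the half-space depends only on the
  number of visits to it, hence is unchanged when the cut point is moved to the origin. This is why
  the removed part carries the law \<open>P0\<close>: moved to the origin, it never leaves the
  half-space.

  Cutting at the last inner separating level leaves a part of the same kind, started from
  \<open>S0\<close>, with one separating level less, so a single induction on \<open>m\<close>
  suffices. The first coordinate rises by at most one per step only almost surely; paths violating
  this have probability 0 and are carried along, so that the recursion holds for every
  \<open>y\<close>.\<close>

lemma less_Inf_enat_iff: "enat K < Inf {enat t | t. P t} \<longleftrightarrow> (\<forall>t\<le>K. \<not> P t)"
proof
  assume L: "enat K < Inf {enat t | t. P t}"
  show "\<forall>t\<le>K. \<not> P t"
  proof (intro allI impI notI)
    fix t assume "t \<le> K" "P t"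
    then have "Inf {enat t | t. P t} \<le> enat t" by (intro Inf_lower) auto
    also have "enat t \<le> enat K" using \<open>t \<le> K\<close> by simp
    finally show False using L by simp
  qed
next
  assume R: "\<forall>t\<le>K. \<not> P t"
  have "enat (Suc K) \<le> Inf {enat t | t. P t}"
  proof (intro Inf_greatest)
    fix a assume "a \<in> {enat t | t. P t}"
    then obtain t where "a = enat t" "P t" by blast
    moreover from this have "Suc K \<le> t" using R by (metis not_less_eq_eq)
    ultimately show "enat (Suc K) \<le> a" by simp
  qed
  then show "enat K < Inf {enat t | t. P t}"
    by (metis Suc_ile_eq)
qed

lemma Inf_enat_eq_iff: "Inf {enat t | t. P t} = enat K \<longleftrightarrow> P K \<and> (\<forall>t<K. \<not> P t)"
proof
  assume L: "Inf {enat t | t. P t} = enat K"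
  have 1: "\<not> P t" if "t < K" for t
    using that L less_Inf_enat_iff[of t P] by auto
  moreover have "P K"
    using L 1 less_Inf_enat_iff[of K P] by (metis le_neq_implies_less less_irrefl)
  ultimately show "P K \<and> (\<forall>t<K. \<not> P t)" by auto
next
  assume R: "P K \<and> (\<forall>t<K. \<not> P t)"
  show "Inf {enat t | t. P t} = enat K"
  proof (rule antisym)
    show "Inf {enat t | t. P t} \<le> enat K" using R by (intro Inf_lower) auto
    show "enat K \<le> Inf {enat t | t. P t}"
      using R by (intro Inf_greatest) (auto simp: not_less[symmetric])
  qed
qed

lemma alpha_eq_iff: "alpha e s n = enat K \<longleftrightarrow> int n \<le> s K $ e \<and> (\<forall>t<K. s t $ e < int n)"
  unfolding alpha_def Inf_enat_eq_iff by (auto simp: not_le)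

lemma alpha_mono: "k \<le> n \<Longrightarrow> alpha e s k \<le> alpha e s n"
  unfolding alpha_def by (rule Inf_superset_mono) auto

lemma local_time_eq_card: "local_time s t x = card {j\<in>{..t}. s j = x}"
  unfolding local_time_def by (simp add: of_bool_def sum.If_cases atLeast0AtMost Int_def)

lemma local_time_mono: "t \<le> t' \<Longrightarrow> local_time s t x \<le> local_time s t' x"
  unfolding local_time_eq_card by (rule card_mono) auto

lemma local_time_cong: "(\<And>j. j \<le> t \<Longrightarrow> s j = s' j) \<Longrightarrow> local_time s t x = local_time s' t x"
  unfolding local_time_eq_card by (metis (mono_tags, lifting) atMost_iff)

text \<open>Visits only accumulate, so a constraint binds hardest at the last visit to its site up
  to \<open>K\<close>, when the count is already the final one. Survival thus becomes one condition
  per visited site, independent of the order of visits.\<close>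

lemma less_T_star_iff:
  "enat K < T_star s h \<longleftrightarrow> (\<forall>x\<in>s ` {..K}. enat (local_time s K x) \<le> h x)"
proof -
  have "enat K < T_star s h \<longleftrightarrow> (\<forall>t\<le>K. enat (local_time s t (s t)) \<le> h (s t))"
    unfolding T_star_def less_Inf_enat_iff by (auto simp: not_less)
  also have "\<dots> \<longleftrightarrow> (\<forall>x\<in>s ` {..K}. enat (local_time s K x) \<le> h x)"
  proof (intro iffI ballI allI impI)
    fix x assume L: "\<forall>t\<le>K. enat (local_time s t (s t)) \<le> h (s t)" and x: "x \<in> s ` {..K}"
    define t where "t = Max {j\<in>{..K}. s j = x}"
    have "t \<in> {j\<in>{..K}. s j = x}"
      unfolding t_def by (rule Max_in) (use x in auto)
    moreover have "j \<le> t" if "j \<le> K" "s j = x" for j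
      unfolding t_def by (rule Max_ge) (use that in auto)
    ultimately have "t \<le> K" "s t = x" "{j\<in>{..K}. s j = x} = {j\<in>{..t}. s j = x}"
      by (auto intro: order_trans)
    then show "enat (local_time s K x) \<le> h x"
      using L unfolding local_time_eq_card by metis
  next
    fix t assume R: "\<forall>x\<in>s ` {..K}. enat (local_time s K x) \<le> h x" and "t \<le> K"
    then show "enat (local_time s t (s t)) \<le> h (s t)"
      by (meson atMost_iff enat_ord_simps(1) image_eqI local_time_mono order_trans)
  qed
  finally show ?thesis .
qed

lemma less_T_star_cong:
  assumes "\<And>t. t \<le> K \<Longrightarrow> s t = s' t"
  shows "enat K < T_star s h \<longleftrightarrow> enat K < T_star s' h"
proof -
  have "s ` {..K} = s' ` {..K}" using assms by (intro image_cong) auto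
  then show ?thesis
    unfolding less_T_star_iff using local_time_cong[of K s s', OF assms] by simp
qed

lemma alpha_eq_cong:
  assumes "\<And>t. t \<le> K \<Longrightarrow> s t = s' t" and "J \<le> K"
  shows "alpha e s n = enat J \<longleftrightarrow> alpha e s' n = enat J"
  using assms unfolding alpha_eq_iff by auto

text \<open>Stated for arbitrary paths, since measurability of path events has to be settled before
  almost sure properties of the steps can be used. Both extrema in the definition only look at times
  before \<open>K\<close>.\<close>

lemma separating_cong:
  assumes eq: "\<And>t. t \<le> K \<Longrightarrow> s t = s' t" and aK: "alpha e s n = enat K"
  shows "separating e s n k \<longleftrightarrow> separating e s' n k"
proof (cases "k \<le> n")
  case True
  have aK': "alpha e s' n = enat K"
    using aK alpha_eq_cong[of K s s' K, OF eq order_refl] by simp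
  obtain J where J: "alpha e s k = enat J" "J \<le> K"
    using alpha_mono[OF True, of e s] aK by (metis enat_ile enat_ord_simps(1))
  then have J': "alpha e s' k = enat J"
    using alpha_eq_cong[of K s s' J, OF eq] by simp
  have "(SUP t\<in>{t. t < J}. ereal (real_of_int (s t $ e)))
      = (SUP t\<in>{t. t < J}. ereal (real_of_int (s' t $ e)))"
    using J(2) eq by (intro SUP_cong) auto
  moreover have "(INF t\<in>{t. J < t \<and> t < K}. ereal (real_of_int (s t $ e)))
      = (INF t\<in>{t. J < t \<and> t < K}. ereal (real_of_int (s' t $ e)))"
    using eq by (intro INF_cong) auto
  ultimately show ?thesis
    unfolding separating_def aK aK' J(1) J' using eq[OF J(2)] by simp
qed (simp add: separating_def)

section \<open>Separating levels of integer paths with upward steps at most one\<close>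

definition first_at :: "(nat \<Rightarrow> int) \<Rightarrow> int \<Rightarrow> nat \<Rightarrow> bool" where
  "first_at g k j \<longleftrightarrow> g j = k \<and> (\<forall>t<j. g t < k)"

definition skip_free :: "(nat \<Rightarrow> int) \<Rightarrow> nat \<Rightarrow> bool" where
  "skip_free g K \<longleftrightarrow> g 0 \<le> 0 \<and> (\<forall>t<K. g (Suc t) \<le> g t + 1)"

text \<open>The top level \<open>n\<close> does not occur: the path is just stopped at time
  \<open>K\<close>, which makes the notion applicable to prefixes and shifted remainders. The lower
  bound includes both end points; this costs nothing when the path stops at its first visit to a
  level at least \<open>k\<close>.\<close>

definition seps :: "(nat \<Rightarrow> int) \<Rightarrow> nat \<Rightarrow> nat set" where
  "seps g K = {k. \<exists>j\<le>K. first_at g (int k) j \<and> (\<forall>t\<in>{j..K}. int k \<le> g t)}"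

lemma first_at_unique: "first_at g k i \<Longrightarrow> first_at g k j \<Longrightarrow> i = j"
  unfolding first_at_def by (metis less_irrefl linorder_neqE_nat)

lemma skip_free_le: "skip_free g K \<Longrightarrow> g K \<le> int K"
proof (induction K)
  case (Suc K)
  then have "skip_free g K" by (simp add: skip_free_def)
  with Suc show ?case by (force simp: skip_free_def)
qed (simp add: skip_free_def)

lemma skip_free_mono: "skip_free g K \<Longrightarrow> J \<le> K \<Longrightarrow> skip_free g J"
  unfolding skip_free_def by auto

lemma skip_free_split:
  assumes "j \<le> K"
  shows "skip_free g K \<longleftrightarrow> skip_free g j \<and> skip_free (\<lambda>t. g (j + t) - g j) (K - j)"
proof
  assume "skip_free g K"
  then show "skip_free g j \<and> skip_free (\<lambda>t. g (j + t) - g j) (K - j)"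
    using assms unfolding skip_free_def by auto
next
  assume R: "skip_free g j \<and> skip_free (\<lambda>t. g (j + t) - g j) (K - j)"
  show "skip_free g K"
    unfolding skip_free_def
  proof (intro conjI allI impI)
    fix t assume "t < K"
    show "g (Suc t) \<le> g t + 1"
    proof (cases "t < j")
      case False
      then have "t - j < K - j" using \<open>t < K\<close> by auto
      then have "g (j + Suc (t - j)) - g j \<le> g (j + (t - j)) - g j + 1"
        using R unfolding skip_free_def by blast
      then show ?thesis using False by simp
    qed (use R in \<open>auto simp: skip_free_def\<close>)
  qed (use R in \<open>simp add: skip_free_def\<close>)
qed

text \<open>A path that starts at or below 0 and rises by at most one per step cannot jump over
  level \<open>n\<close>; for \<open>K = 0\<close> the bound on the start replaces the bound on the
  step.\<close>

lemma alpha_eq_iff_first_at: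
  assumes "skip_free (\<lambda>t. s t $ e) K"
  shows "alpha e s n = enat K \<longleftrightarrow> first_at (\<lambda>t. s t $ e) (int n) K"
proof -
  have "s K $ e \<le> int n" if "\<forall>t<K. s t $ e < int n"
  proof (cases K)
    case (Suc t)
    then have "s (Suc t) $ e \<le> s t $ e + 1" "s t $ e < int n"
      using assms that unfolding skip_free_def by auto
    then show ?thesis using Suc by simp
  qed (use assms in \<open>simp add: skip_free_def\<close>)
  then show ?thesis unfolding alpha_eq_iff first_at_def by auto
qed

lemma seps_le: "first_at g (int n) K \<Longrightarrow> k \<in> seps g K \<Longrightarrow> k \<le> n"
  unfolding seps_def first_at_def by force

lemma seps_finite: "first_at g (int n) K \<Longrightarrow> finite (seps g K)"
  by (rule finite_subset[of _ "{..n}"]) (auto dest: seps_le)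

lemma seps_top: "first_at g (int n) K \<Longrightarrow> n \<in> seps g K"
  unfolding seps_def first_at_def by force

lemma separating_iff_seps:
  assumes sf: "skip_free (\<lambda>t. s t $ e) K" and f: "first_at (\<lambda>t. s t $ e) (int n) K"
  shows "separating e s n k \<longleftrightarrow> k \<in> seps (\<lambda>t. s t $ e) K"
proof -
  have aK: "alpha e s n = enat K"
    using alpha_eq_iff_first_at[OF sf] f by blast
  have key: "separating e s n k \<longleftrightarrow> (\<forall>t\<in>{J..K}. int k \<le> s t $ e)"
    if k: "k \<le> n" and J: "first_at (\<lambda>t. s t $ e) (int k) J" "J \<le> K" for J
  proof -
    have aJ: "alpha e s k = enat J"
      using alpha_eq_iff_first_at[OF skip_free_mono[OF sf J(2)]] J(1) by blast
    \<comment> \<open>Integrality: values below \<open>k\<close> are at most \<open>k - 1\<close>,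
      so even the supremum stays strictly below \<open>k\<close>.\<close>
    have "(SUP t\<in>{t. t < J}. ereal (real_of_int (s t $ e))) \<le> ereal (real k - 1)"
    proof (rule SUP_least)
      fix t assume "t \<in> {t. t < J}"
      then have "s t $ e \<le> int k - 1" using J(1) by (auto simp: first_at_def)
      then have "real_of_int (s t $ e) \<le> real k - 1" by linarith
      then show "ereal (real_of_int (s t $ e)) \<le> ereal (real k - 1)" by simp
    qed
    also have "ereal (real k - 1) < ereal (real k)" by simp
    finally have sup: "(SUP t\<in>{t. t < J}. ereal (real_of_int (s t $ e))) < ereal (real k)" .
    have "ereal (real k) \<le> (INF t\<in>{t. J < t \<and> t < K}. ereal (real_of_int (s t $ e)))
       \<longleftrightarrow> (\<forall>t. J < t \<and> t < K \<longrightarrow> int k \<le> s t $ e)"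
    proof -
      have "ereal (real k) \<le> ereal (real_of_int z) \<longleftrightarrow> int k \<le> z" for z by auto
      then show ?thesis unfolding le_INF_iff by simp
    qed
    \<comment> \<open>The open time range may be closed, as the path is at \<open>k\<close> at time
      \<open>J\<close> and at \<open>n \<ge> k\<close> at time \<open>K\<close>.\<close>
    also have "\<dots> \<longleftrightarrow> (\<forall>t\<in>{J..K}. int k \<le> s t $ e)"
    proof -
      have "int k \<le> s J $ e" "int k \<le> s K $ e" using J(1) f k by (auto simp: first_at_def)
      then show ?thesis by (metis atLeastAtMost_iff le_neq_implies_less less_imp_le_nat)
    qed
    finally have "ereal (real k) \<le> (INF t\<in>{t. J < t \<and> t < K}. ereal (real_of_int (s t $ e)))
       \<longleftrightarrow> (\<forall>t\<in>{J..K}. int k \<le> s t $ e)" .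
    then show ?thesis
      unfolding separating_def aK aJ using sup k J(1) by (simp add: first_at_def)
  qed
  show ?thesis
  proof
    assume sep: "separating e s n k"
    then have k: "k \<le> n" by (simp add: separating_def)
    obtain J where J: "alpha e s k = enat J" "J \<le> K"
      using alpha_mono[OF k, of e s] aK by (metis enat_ile enat_ord_simps(1))
    then have "first_at (\<lambda>t. s t $ e) (int k) J"
      using alpha_eq_iff_first_at[OF skip_free_mono[OF sf J(2)]] by blast
    with key[OF k this J(2)] sep J(2) show "k \<in> seps (\<lambda>t. s t $ e) K"
      unfolding seps_def by blast
  next
    assume ks: "k \<in> seps (\<lambda>t. s t $ e) K"
    with key[OF seps_le[OF f ks]] show "separating e s n k"
      unfolding seps_def by blast
  qed
qed

lemma eta_eq_card_seps:
  assumes "skip_free (\<lambda>t. s t $ e) K" "first_at (\<lambda>t. s t $ e) (int n) K" "enat K < T_star s h"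
  shows "eta e s h n = int (card (seps (\<lambda>t. s t $ e) K)) - 1"
proof -
  have "{k. separating e s n k} = seps (\<lambda>t. s t $ e) K"
    using separating_iff_seps[OF assms(1,2)] by auto
  moreover have "event_B e s h n"
    using assms(2,3) unfolding event_B_def alpha_eq_iff_first_at[OF assms(1), symmetric] by simp
  ultimately show ?thesis unfolding eta_def by simp
qed

text \<open>\<open>n\<close> itself always separates, so \<open>eta\<close> counts the separating
  levels below \<open>n\<close>. If the largest of these is 0, it is the only one; if there is none,
  \<open>kappa\<close> is minus infinity and not 0.\<close>

lemma kappa_eq_0_iff_seps:
  assumes "skip_free (\<lambda>t. s t $ e) K" "first_at (\<lambda>t. s t $ e) (int n) K" "enat K < T_star s h"
  shows "kappa e s h n = 0 \<longleftrightarrow> 1 \<le> n \<and> seps (\<lambda>t. s t $ e) K = {0, n}"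
proof -
  let ?A = "seps (\<lambda>t. s t $ e) K"
  have fin: "finite ?A" and top: "n \<in> ?A" and le: "\<And>k. k \<in> ?A \<Longrightarrow> k \<le> n"
    using seps_finite seps_top seps_le assms(2) by blast+
  have "card {k \<in> ?A. k < n} = card (?A - {n})"
    by (rule arg_cong[where f=card]) (use le in force)
  also have "\<dots> = card ?A - 1" using fin top by simp
  finally have card: "card {k \<in> ?A. k < n} = card ?A - 1" .
  have ge: "eta e s h n \<ge> 1 \<longleftrightarrow> {k \<in> ?A. k < n} \<noteq> {}"
  proof -
    have "{k \<in> ?A. k < n} \<noteq> {} \<longleftrightarrow> 0 < card {k \<in> ?A. k < n}"
      using fin by (simp add: card_gt_0_iff)
    then show ?thesis
      unfolding eta_eq_card_seps[OF assms] using card by auto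
  qed
  have "kappa e s h n = 0 \<longleftrightarrow> {k \<in> ?A. k < n} \<noteq> {} \<and> Max {k \<in> ?A. k < n} = 0"
    unfolding kappa_def ge using separating_iff_seps[OF assms(1,2)] by auto
  also have "\<dots> \<longleftrightarrow> {k \<in> ?A. k < n} = {0}"
  proof
    assume L: "{k \<in> ?A. k < n} \<noteq> {} \<and> Max {k \<in> ?A. k < n} = 0"
    then have "k = 0" if "k \<in> {k \<in> ?A. k < n}" for k
      using Max_ge[OF _ that] fin by auto
    with L show "{k \<in> ?A. k < n} = {0}" by blast
  qed auto
  also have "\<dots> \<longleftrightarrow> 1 \<le> n \<and> ?A = {0, n}"
  proof -
    have A: "?A = insert n {k \<in> ?A. k < n}" using top le by (auto simp: le_less)
    show ?thesis
    proof
      assume L: "{k \<in> ?A. k < n} = {0}"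
      then have "0 < n" by blast
      moreover have "?A = {n, 0}" using A unfolding L .
      ultimately show "1 \<le> n \<and> ?A = {0, n}" by auto
    qed auto
  qed
  finally show ?thesis .
qed

text \<open>Levels below \<open>k\<close> are first hit before time \<open>j\<close> and never
  undercut afterwards, so only the prefix matters for them. Level \<open>k + i\<close> is not hit
  before \<open>j\<close>, so it separates exactly when \<open>i\<close> does for the remainder
  moved to the origin. The cut level belongs to the second set, with \<open>i = 0\<close>.\<close>

lemma seps_split:
  assumes f: "first_at g (int k) j" and j: "j \<le> K" and ge: "\<And>t. j \<le> t \<Longrightarrow> t \<le> K \<Longrightarrow> int k \<le> g t"
  shows "seps g K = {i \<in> seps g j. i < k} \<union> (+) k ` seps (\<lambda>t. g (j + t) - g j) (K - j)"
proof -
  have gj: "g j = int k" using f by (simp add: first_at_def)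
  have low: "i \<in> seps g K \<longleftrightarrow> i \<in> seps g j" if "i < k" for i
  proof -
    have "r \<le> j" if "first_at g (int i) r" for r
      using that gj \<open>i < k\<close> unfolding first_at_def by (auto simp: not_less[symmetric])
    moreover have "int i \<le> g t" if "j \<le> t" "t \<le> K" for t
      using ge[OF that] \<open>i < k\<close> by simp
    ultimately have "r \<le> K \<and> first_at g (int i) r \<and> (\<forall>t\<in>{r..K}. int i \<le> g t) \<longleftrightarrow>
        r \<le> j \<and> first_at g (int i) r \<and> (\<forall>t\<in>{r..j}. int i \<le> g t)" for r
      using j by (metis atLeastAtMost_iff le_trans nat_le_linear)
    then show ?thesis unfolding seps_def by simp
  qed
  have high: "k + i \<in> seps g K \<longleftrightarrow> i \<in> seps (\<lambda>t. g (j + t) - g j) (K - j)" for i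
  proof
    assume "k + i \<in> seps g K"
    then obtain r where r: "r \<le> K" "first_at g (int (k + i)) r" "\<forall>t\<in>{r..K}. int (k + i) \<le> g t"
      by (auto simp: seps_def)
    have "j \<le> r"
      using r(2) f unfolding first_at_def by (metis le_add1 linorder_not_le of_nat_mono)
    have "int i \<le> g (j + t) - g j" if "t \<in> {r - j..K - j}" for t
    proof -
      have "j + t \<in> {r..K}" using that \<open>j \<le> r\<close> j by auto
      then show ?thesis using r(3) gj by force
    qed
    moreover have "first_at (\<lambda>t. g (j + t) - g j) (int i) (r - j)"
      using r(2) gj \<open>j \<le> r\<close> unfolding first_at_def by (auto simp: less_diff_conv algebra_simps)
    ultimately have "r - j \<le> K - j \<and> first_at (\<lambda>t. g (j + t) - g j) (int i) (r - j) \<and>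
       (\<forall>t\<in>{r - j..K - j}. int i \<le> g (j + t) - g j)"
      using r(1) by (simp add: diff_le_mono)
    then show "i \<in> seps (\<lambda>t. g (j + t) - g j) (K - j)"
      unfolding seps_def by blast
  next
    assume "i \<in> seps (\<lambda>t. g (j + t) - g j) (K - j)"
    then obtain r where r: "r \<le> K - j" "first_at (\<lambda>t. g (j + t) - g j) (int i) r"
       "\<forall>t\<in>{r..K - j}. int i \<le> g (j + t) - g j"
      by (auto simp: seps_def)
    have "g t < int (k + i)" if "t < j + r" for t
    proof (cases "t < j")
      case True
      then show ?thesis using f by (auto simp: first_at_def)
    next
      case False
      then have "g (j + (t - j)) - g j < int i"
        using r(2) that unfolding first_at_def by (metis add_diff_inverse_nat nat_add_left_cancel_less)
      then show ?thesis using False gj by simp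
    qed
    moreover have "int (k + i) \<le> g t" if "t \<in> {j + r..K}" for t
    proof -
      have "int i \<le> g (j + (t - j)) - g j" using r(3) that by (metis (no_types, lifting) add.commute atLeastAtMost_iff diff_le_mono le_diff_conv2 add_leD1)
      then show ?thesis using that gj by simp
    qed
    moreover have "g (j + r) = int (k + i)" using r(2) gj by (simp add: first_at_def)
    moreover have "j + r \<le> K" using r(1) j by simp
    ultimately show "k + i \<in> seps g K"
      unfolding seps_def first_at_def by blast
  qed
  show ?thesis
  proof (intro set_eqI iffI)
    fix i assume "i \<in> seps g K"
    then show "i \<in> {i \<in> seps g j. i < k} \<union> (+) k ` seps (\<lambda>t. g (j + t) - g j) (K - j)"
      using low[of i] high[of "i - k"] by (cases "i < k") (auto simp: image_iff intro!: bexI[of _ "i - k"])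
  qed (use low high in auto)
qed

text \<open>The first visit to 0 is at time 0, so the bound for level 0 covers the whole
  path.\<close>

lemma zero_mem_seps:
  assumes "0 \<in> seps g K" "g 0 = 0" "t \<le> K"
  shows "0 \<le> g t"
  using assms unfolding seps_def first_at_def by (force simp: not_less)

text \<open>The cut level \<open>k\<close> is both the top level of the prefix and level 0 of the
  cycle, so gluing adds just one separating level, \<open>k + l\<close>. The lower bound after time
  \<open>j\<close> comes from 0 being a separating level of the cycle.\<close>

lemma seps_compose:
  assumes f: "first_at g (int k) j" and j: "j \<le> K" and l: "1 \<le> l"
    and f': "first_at (\<lambda>t. g (j + t) - g j) (int l) (K - j)"
    and s': "seps (\<lambda>t. g (j + t) - g j) (K - j) = {0, l}"
  shows "first_at g (int (k + l)) K" and "seps g K = insert (k + l) (seps g j)"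
    and "\<And>t. j \<le> t \<Longrightarrow> t \<le> K \<Longrightarrow> int k \<le> g t"
proof -
  have gj: "g j = int k" using f by (simp add: first_at_def)
  show ge: "int k \<le> g t" if "j \<le> t" "t \<le> K" for t
    using zero_mem_seps[of "\<lambda>t. g (j + t) - g j" "K - j" "t - j"] s' that gj by simp
  have "g t < int (k + l)" if "t < K" for t
  proof (cases "t < j")
    case False
    then have "g (j + (t - j)) - g j < int l"
      using f' that unfolding first_at_def by (meson diff_less_mono not_less)
    then show ?thesis using False gj by simp
  qed (use f in \<open>auto simp: first_at_def\<close>)
  then show "first_at g (int (k + l)) K"
    using f' j gj by (simp add: first_at_def)
  have "seps g j = insert k {i \<in> seps g j. i < k}"
    using seps_top[OF f] seps_le[OF f] by (auto simp: le_less)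
  then show "seps g K = insert (k + l) (seps g j)"
    using seps_split[OF f j ge] s' by auto
qed

lemma seps_decompose:
  assumes f: "first_at g (int n) K" and c: "card (seps g K) = Suc (Suc m)"
  obtains j k where "j \<le> K" "k < n" "first_at g (int k) j" "card (seps g j) = Suc m"
    "first_at (\<lambda>t. g (j + t) - g j) (int (n - k)) (K - j)"
    "seps (\<lambda>t. g (j + t) - g j) (K - j) = {0, n - k}"
proof -
  have fin: "finite (seps g K)" and top: "n \<in> seps g K" and le: "\<And>k. k \<in> seps g K \<Longrightarrow> k \<le> n"
    using seps_finite seps_top seps_le f by blast+
  \<comment> \<open>Cardinality at least 2 makes this set nonempty; maximality of \<open>k\<close>
    leaves the remainder without separating levels strictly between its two ends.\<close>
  define k where "k = Max (seps g K - {n})"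
  have ne: "seps g K - {n} \<noteq> {}"
    using c fin top by (metis card.empty card_Suc_Diff1 diff_Suc_1 nat.simps(3))
  then have k: "k \<in> seps g K" "k \<noteq> n"
    using Max_in[of "seps g K - {n}"] fin unfolding k_def by auto
  then have kn: "k < n" using le by force
  have max: "i \<le> k" if "i \<in> seps g K" "i \<noteq> n" for i
    unfolding k_def using that fin by (intro Max_ge) auto
  obtain j where j: "j \<le> K" "first_at g (int k) j" "\<forall>t\<in>{j..K}. int k \<le> g t"
    using k(1) unfolding seps_def by blast
  have gj: "g j = int k" using j(2) by (simp add: first_at_def)
  let ?g = "\<lambda>t. g (j + t) - g j"
  have split: "seps g K = {i \<in> seps g j. i < k} \<union> (+) k ` seps ?g (K - j)"
    using seps_split[OF j(2,1)] j(3) by auto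
  have jK: "first_at ?g (int (n - k)) (K - j)"
    using f gj j(1) kn unfolding first_at_def by (auto simp: algebra_simps of_nat_diff)
  have s': "seps ?g (K - j) = {0, n - k}"
  proof (intro set_eqI iffI)
    fix i assume "i \<in> seps ?g (K - j)"
    then have "k + i \<in> seps g K" using split by auto
    then show "i \<in> {0, n - k}" using max[of "k + i"] by auto
  next
    have "first_at ?g 0 0" by (simp add: first_at_def)
    moreover have "int 0 \<le> ?g t" if "t \<in> {0..K - j}" for t
    proof -
      have "j + t \<in> {j..K}" using that j(1) by auto
      then show ?thesis using j(3) gj by force
    qed
    ultimately have "0 \<in> seps ?g (K - j)"
      unfolding seps_def by force
    then show "i \<in> seps ?g (K - j)" if "i \<in> {0, n - k}" for i
      using that seps_top[OF jK] by auto
  qed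
  have "seps g K = insert n (seps g j)"
    using seps_compose(2)[OF j(2,1) _ jK s'] kn by simp
  moreover have "n \<notin> seps g j" using seps_le[OF j(2), of n] kn by auto
  ultimately have "card (seps g j) = Suc m"
    using c fin by (metis card_insert_disjoint diff_Suc_1 finite_insert)
  with that[OF j(1) kn j(2)] jK s' show thesis by blast
qed

subsection \<open>Path probabilities\<close>

lemma walk_eq_iff:
  "(\<forall>t\<le>K. walk s0 x t = y t) \<longleftrightarrow> s0 = y 0 \<and> (\<forall>i\<in>{1..K}. x i = y i - y (i - 1))"
proof (induction K)
  case 0
  show ?case by (simp add: walk_def)
next
  case (Suc K)
  have "(\<forall>t\<le>Suc K. walk s0 x t = y t) \<longleftrightarrow> (\<forall>t\<le>K. walk s0 x t = y t) \<and> walk s0 x (Suc K) = y (Suc K)"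
    by (auto simp: le_Suc_eq)
  also have "\<dots> \<longleftrightarrow> (\<forall>t\<le>K. walk s0 x t = y t) \<and> x (Suc K) = y (Suc K) - y K"
  proof -
    have "walk s0 x (Suc K) = walk s0 x K + x (Suc K)" by (simp add: walk_def algebra_simps)
    then show ?thesis by (metis add_diff_cancel_left' diff_add_cancel add.commute order_refl)
  qed
  also have "\<dots> \<longleftrightarrow> s0 = y 0 \<and> (\<forall>i\<in>{1..Suc K}. x i = y i - y (i - 1))"
    unfolding Suc by (auto simp: atLeastAtMostSuc_conv)
  finally show ?case .
qed

lemma (in prob_space) prob_all_indep:
  assumes "indep_vars (\<lambda>_. count_space UNIV) X I" "J \<subseteq> I" "finite J"
  shows "prob {w\<in>space M. \<forall>i\<in>J. X i w \<in> A i} = (\<Prod>i\<in>J. prob {w\<in>space M. X i w \<in> A i})"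
proof (cases "J = {}")
  case True
  then show ?thesis by (simp add: prob_space)
next
  case False
  have "prob (\<Inter>i\<in>J. X i -` A i \<inter> space M) = (\<Prod>i\<in>J. prob (X i -` A i \<inter> space M))"
    by (rule indep_varsD[OF assms(1) False assms(3,2)]) simp
  moreover have "(\<Inter>i\<in>J. X i -` A i \<inter> space M) = {w\<in>space M. \<forall>i\<in>J. X i w \<in> A i}"
    using False by auto
  moreover have "X i -` A i \<inter> space M = {w\<in>space M. X i w \<in> A i}" for i by auto
  ultimately show ?thesis by simp
qed

lemma measure_Collect_distr_eq:
  assumes "X \<in> M \<rightarrow>\<^sub>M count_space UNIV" "Y \<in> M \<rightarrow>\<^sub>M count_space UNIV"
    and "distr M (count_space UNIV) X = distr M (count_space UNIV) Y"
  shows "measure M {w\<in>space M. X w \<in> A} = measure M {w\<in>space M. Y w \<in> A}"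
proof -
  have "measure M {w\<in>space M. X w \<in> A} = measure (distr M (count_space UNIV) X) A"
    using assms(1) by (subst measure_distr) (auto intro!: arg_cong[where f="measure M"])
  also have "\<dots> = measure M {w\<in>space M. Y w \<in> A}"
    unfolding assms(3) using assms(2) by (subst measure_distr) (auto intro!: arg_cong[where f="measure M"])
  finally show ?thesis .
qed

section \<open>The probability of following a fixed path within the constraints\<close>

locale constrained_walk = prob_space M
  for M :: "'w measure" +
  fixes e :: "'d::finite" and S0 :: "'w \<Rightarrow> int ^ 'd" and xi :: "'w \<Rightarrow> nat \<Rightarrow> int ^ 'd"
    and H :: "'w \<Rightarrow> int ^ 'd \<Rightarrow> enat"
  assumes a1: "A1 M e xi" and a2: "A2 M e S0 xi H" and a3: "A3 M e H"
begin

definition "gen_start =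
  {S0 -` A \<inter> space M | A. True} \<union> {(\<lambda>w. H w x) -` A \<inter> space M | x A. \<not> x $ e \<ge> 0}"
definition "gen_steps = {(\<lambda>w. xi w i) -` A \<inter> space M | i A. i \<ge> (1::nat)}"
definition "gen_half = {(\<lambda>w. H w x) -` A \<inter> space M | x A. x $ e \<ge> 0}"

abbreviation "sig G \<equiv> sigma_sets (space M) G"

lemma gen_subset: "gen_start \<subseteq> Pow (space M)" "gen_steps \<subseteq> Pow (space M)" "gen_half \<subseteq> Pow (space M)"
  unfolding gen_start_def gen_steps_def gen_half_def by auto

lemma indep_families:
  "indep_sets (\<lambda>i::nat. sig ([gen_start, gen_steps, gen_half] ! i)) {0, 1, 2}"
  using a2 unfolding A2_def gen_start_def gen_steps_def gen_half_def by blast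

lemma sig_events: "sig gen_start \<subseteq> events" "sig gen_steps \<subseteq> events" "sig gen_half \<subseteq> events"
proof -
  have "sig ([gen_start, gen_steps, gen_half] ! i) \<subseteq> events" if "i \<in> {0, 1, 2}" for i
    using indep_families that unfolding indep_sets_def by blast
  from this[of 0] this[of 1] this[of 2]
  show "sig gen_start \<subseteq> events" "sig gen_steps \<subseteq> events" "sig gen_half \<subseteq> events" by simp_all
qed

lemma prob_three:
  assumes "A \<in> sig gen_start" "B \<in> sig gen_steps" "C \<in> sig gen_half"
  shows "prob (A \<inter> B \<inter> C) = prob A * prob B * prob C"
proof -
  have "prob (\<Inter>i\<in>{0,1,2::nat}. [A, B, C] ! i) = (\<Prod>i\<in>{0,1,2::nat}. prob ([A, B, C] ! i))"
    by (rule indep_setsD[OF indep_families]) (use assms in auto)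
  then show ?thesis by (simp add: Int_assoc mult.assoc)
qed

lemma prob_two:
  assumes "B \<in> sig gen_steps" "C \<in> sig gen_half"
  shows "prob (B \<inter> C) = prob B * prob C"
proof -
  have "space M \<in> sig gen_start" by (rule sigma_sets_top)
  moreover have "B \<subseteq> space M" using assms(1) gen_subset(2) sigma_sets_into_sp by blast
  ultimately show ?thesis
    using prob_three[of "space M" B C] assms by (simp add: prob_space Int_absorb1)
qed

lemma start_in_sig: "S0 -` A \<inter> space M \<in> sig gen_start"
  by (rule sigma_sets.Basic) (auto simp: gen_start_def)
lemma H_neg_in_sig: "\<not> x $ e \<ge> 0 \<Longrightarrow> (\<lambda>w. H w x) -` A \<inter> space M \<in> sig gen_start"
  by (rule sigma_sets.Basic) (auto simp: gen_start_def)
lemma xi_in_sig: "i \<ge> 1 \<Longrightarrow> (\<lambda>w. xi w i) -` A \<inter> space M \<in> sig gen_steps"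
  by (rule sigma_sets.Basic) (auto simp: gen_steps_def)
lemma H_half_in_sig: "x $ e \<ge> 0 \<Longrightarrow> (\<lambda>w. H w x) -` A \<inter> space M \<in> sig gen_half"
  by (rule sigma_sets.Basic) (auto simp: gen_half_def)

lemma measurable_S0 [measurable]: "S0 \<in> M \<rightarrow>\<^sub>M count_space UNIV"
  using start_in_sig sig_events by (intro measurableI) auto
lemma measurable_xi: "i \<ge> 1 \<Longrightarrow> (\<lambda>w. xi w i) \<in> M \<rightarrow>\<^sub>M count_space UNIV"
  using xi_in_sig sig_events by (intro measurableI) auto
lemma measurable_H [measurable]: "(\<lambda>w. H w x) \<in> M \<rightarrow>\<^sub>M count_space UNIV"
  using H_neg_in_sig[of x] H_half_in_sig[of x] sig_events by (intro measurableI; cases "x $ e \<ge> 0") auto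

lemma measurable_walk [measurable]: "(\<lambda>w. walk (S0 w) (xi w) t) \<in> M \<rightarrow>\<^sub>M count_space UNIV"
proof (induction t)
  case 0
  then show ?case by (simp add: walk_def)
next
  case (Suc t)
  have [measurable]: "(\<lambda>w. xi w (Suc t)) \<in> M \<rightarrow>\<^sub>M count_space UNIV" by (rule measurable_xi) simp
  have "walk (S0 w) (xi w) (Suc t) = walk (S0 w) (xi w) t + xi w (Suc t)" for w
    by (simp add: walk_def algebra_simps)
  then show ?case using Suc by simp
qed

text \<open>The conditions for following \<open>y\<close> within the constraints are sorted by the
  family of (A2) that decides them. Constraints at sites outside the half-space stay together with
  the starting point, on which they may depend.\<close>

definition "ev_start y K = {w\<in>space M. S0 w = y 0 \<and>
   (\<forall>x\<in>y ` {..K} \<inter> {x. x $ e < 0}. enat (local_time y K x) \<le> H w x)}"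
definition "ev_steps y K = {w\<in>space M. \<forall>i\<in>{1..K}. xi w i = y i - y (i - 1)}"
definition "ev_half y K = {w\<in>space M. \<forall>x\<in>y ` {..K} \<inter> {x. 0 \<le> x $ e}. enat (local_time y K x) \<le> H w x}"

lemma ev_start_sig: "ev_start y K \<in> sig gen_start"
proof -
  interpret s: sigma_algebra "space M" "sig gen_start"
    by (rule sigma_algebra_sigma_sets[OF gen_subset(1)])
  have "{w\<in>space M. enat n \<le> H w x} \<in> sig gen_start" if "x $ e < 0" for n x
  proof -
    have "{w\<in>space M. enat n \<le> H w x} = (\<lambda>w. H w x) -` {enat n..} \<inter> space M" by auto
    then show ?thesis using H_neg_in_sig that by simp
  qed
  moreover have "{w\<in>space M. S0 w = y 0} = S0 -` {y 0} \<inter> space M" by auto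
  ultimately show ?thesis
    unfolding ev_start_def using start_in_sig
    by (intro s.sets_Collect_conj s.sets_Collect_finite_All) auto
qed

lemma ev_steps_sig: "ev_steps y K \<in> sig gen_steps"
proof -
  interpret s: sigma_algebra "space M" "sig gen_steps"
    by (rule sigma_algebra_sigma_sets[OF gen_subset(2)])
  have "{w\<in>space M. xi w i = z} \<in> sig gen_steps" if "i \<ge> 1" for i z
  proof -
    have "{w\<in>space M. xi w i = z} = (\<lambda>w. xi w i) -` {z} \<inter> space M" by auto
    then show ?thesis using xi_in_sig that by simp
  qed
  then show ?thesis
    unfolding ev_steps_def by (intro s.sets_Collect_finite_All) auto
qed

lemma ev_half_sig: "ev_half y K \<in> sig gen_half"
proof -
  interpret s: sigma_algebra "space M" "sig gen_half"
    by (rule sigma_algebra_sigma_sets[OF gen_subset(3)])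
  have "{w\<in>space M. enat n \<le> H w x} \<in> sig gen_half" if "0 \<le> x $ e" for n x
  proof -
    have "{w\<in>space M. enat n \<le> H w x} = (\<lambda>w. H w x) -` {enat n..} \<inter> space M" by auto
    then show ?thesis using H_half_in_sig that by simp
  qed
  then show ?thesis
    unfolding ev_half_def by (intro s.sets_Collect_finite_All) auto
qed

lemma prob_xi_eq: "1 \<le> i \<Longrightarrow> prob {w\<in>space M. xi w i \<in> A} = prob {w\<in>space M. xi w 1 \<in> A}"
  by (rule measure_Collect_distr_eq[OF measurable_xi measurable_xi]) (use a1[unfolded A1_def] in blast)+

lemma prob_H_eq: "0 \<le> x $ e \<Longrightarrow> prob {w\<in>space M. H w x \<in> A} = prob {w\<in>space M. H w 0 \<in> A}"
  by (rule measure_Collect_distr_eq[OF measurable_H measurable_H]) (use a3[unfolded A3_def] in blast)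

definition "step_prob z = prob {w\<in>space M. xi w 1 = z}"
definition "tail_prob n = prob {w\<in>space M. enat n \<le> H w 0}"

lemma prob_ev_steps: "prob (ev_steps y K) = (\<Prod>i\<in>{1..K}. step_prob (y i - y (i - 1)))"
proof -
  have "indep_vars (\<lambda>_. count_space UNIV) (\<lambda>i w. xi w i) {1..}" using a1 unfolding A1_def by blast
  then have "prob {w\<in>space M. \<forall>i\<in>{1..K}. xi w i \<in> {y i - y (i - 1)}}
      = (\<Prod>i\<in>{1..K}. prob {w\<in>space M. xi w i \<in> {y i - y (i - 1)}})"
    by (rule prob_all_indep[of "\<lambda>i w. xi w i" "{1..}"]) auto
  also have "\<dots> = (\<Prod>i\<in>{1..K}. prob {w\<in>space M. xi w 1 \<in> {y i - y (i - 1)}})"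
    by (intro prod.cong refl prob_xi_eq) auto
  finally show ?thesis by (simp add: ev_steps_def step_prob_def)
qed

lemma prob_ev_half:
  "prob (ev_half y K) = (\<Prod>x\<in>y ` {..K} \<inter> {x. 0 \<le> x $ e}. tail_prob (local_time y K x))"
proof -
  let ?J = "y ` {..K} \<inter> {x. 0 \<le> x $ e}"
  have "indep_vars (\<lambda>_. count_space UNIV) (\<lambda>x w. H w x) {x. x $ e \<ge> 0}" using a3 unfolding A3_def by blast
  then have "prob {w\<in>space M. \<forall>x\<in>?J. H w x \<in> {enat (local_time y K x)..}}
      = (\<Prod>x\<in>?J. prob {w\<in>space M. H w x \<in> {enat (local_time y K x)..}})"
    by (rule prob_all_indep[of "\<lambda>x w. H w x" "{x. 0 \<le> x $ e}"]) auto
  also have "\<dots> = (\<Prod>x\<in>?J. prob {w\<in>space M. H w 0 \<in> {enat (local_time y K x)..}})"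
    by (intro prod.cong refl prob_H_eq) auto
  finally show ?thesis by (simp add: ev_half_def tail_prob_def)
qed

lemma tail_prob_1: "tail_prob 1 = 1"
  using a3 by (simp add: tail_prob_def A3_def one_enat_def)

definition "ev_path y K =
  {w\<in>space M. (\<forall>t\<le>K. walk (S0 w) (xi w) t = y t) \<and> enat K < T_star (walk (S0 w) (xi w)) (H w)}"

definition "ev_path0 y K =
  {w\<in>space M. (\<forall>t\<le>K. walk 0 (xi w) t = y t) \<and>
     enat K < T_star (walk 0 (xi w)) (half_space_constraint e (H w))}"

lemma ev_path_eq: "ev_path y K = ev_start y K \<inter> ev_steps y K \<inter> ev_half y K"
proof -
  have "(\<forall>t\<le>K. walk (S0 w) (xi w) t = y t) \<and> enat K < T_star (walk (S0 w) (xi w)) (H w)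
    \<longleftrightarrow> (\<forall>t\<le>K. walk (S0 w) (xi w) t = y t) \<and> enat K < T_star y (H w)" for w
    using less_T_star_cong[of K "walk (S0 w) (xi w)" y "H w"] by blast
  then show ?thesis
    unfolding ev_path_def ev_start_def ev_steps_def ev_half_def walk_eq_iff less_T_star_iff
    by (auto simp: not_less[symmetric])
qed

text \<open>Inside the half-space the modified constraints coincide with \<open>H\<close>, and the
  start is deterministic; so nothing of the first family is left.\<close>

lemma ev_path0_eq:
  assumes "y 0 = 0" "\<And>t. t \<le> K \<Longrightarrow> 0 \<le> y t $ e"
  shows "ev_path0 y K = ev_steps y K \<inter> ev_half y K"
proof -
  have "(\<forall>t\<le>K. walk 0 (xi w) t = y t) \<and> enat K < T_star (walk 0 (xi w)) (half_space_constraint e (H w))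
    \<longleftrightarrow> (\<forall>t\<le>K. walk 0 (xi w) t = y t) \<and> enat K < T_star y (half_space_constraint e (H w))" for w
    using less_T_star_cong[of K "walk 0 (xi w)" y "half_space_constraint e (H w)"] by blast
  then show ?thesis
    unfolding ev_path0_def ev_steps_def ev_half_def walk_eq_iff less_T_star_iff half_space_constraint_def
    using assms by auto
qed

lemma ev_path_events [measurable]: "ev_path y K \<in> events"
  unfolding ev_path_eq using ev_start_sig ev_steps_sig ev_half_sig sig_events by blast

lemma prob_ev_path:
  "prob (ev_path y K) = prob (ev_start y K) * (\<Prod>i\<in>{1..K}. step_prob (y i - y (i - 1))) *
     (\<Prod>x\<in>y ` {..K} \<inter> {x. 0 \<le> x $ e}. tail_prob (local_time y K x))"
  unfolding ev_path_eq prob_three[OF ev_start_sig ev_steps_sig ev_half_sig] prob_ev_steps prob_ev_half ..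

lemma prob_ev_path0:
  assumes "y 0 = 0" "\<And>t. t \<le> K \<Longrightarrow> 0 \<le> y t $ e"
  shows "prob (ev_path0 y K) =  (\<Prod>i\<in>{1..K}. step_prob (y i - y (i - 1))) *
     (\<Prod>x\<in>y ` {..K} \<inter> {x. 0 \<le> x $ e}. tail_prob (local_time y K x))"
  using ev_path0_eq[of y K, OF assms] prob_two[OF ev_steps_sig ev_half_sig]
  by (simp add: prob_ev_steps prob_ev_half)

lemma AE_step_le: "AE w in M. \<forall>i\<ge>1. xi w i $ e \<le> 1"
proof -
  have "AE w in M. xi w i $ e \<le> 1" if "i \<ge> 1" for i
  proof -
    have "prob {w\<in>space M. xi w i \<in> {z. z $ e \<le> 1}} = prob {w\<in>space M. xi w 1 \<in> {z. z $ e \<le> 1}}"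
      by (rule prob_xi_eq[OF that])
    also have "\<dots> = 1" using a1 by (simp add: A1_def)
    finally have "AE w in M. w \<in> {w\<in>space M. xi w i \<in> {z. z $ e \<le> 1}}"
    proof (subst (asm) prob_eq_1)
      show "{w\<in>space M. xi w i \<in> {z. z $ e \<le> 1}} \<in> events"
        using measurable_sets[OF measurable_xi[OF that], of "{z. z $ e \<le> 1}"]
        by (simp add: vimage_def Int_def conj_commute)
    qed
    then show ?thesis by auto
  qed
  then show ?thesis by (auto simp: AE_all_countable)
qed

lemma AE_skip_free: "AE w in M. \<forall>K. skip_free (\<lambda>t. walk (S0 w) (xi w) t $ e) K"
proof -
  have "AE w in M. S0 w $ e \<le> 0" using a2 by (simp add: A2_def)
  with AE_step_le show ?thesis
  proof eventually_elim
    case (elim w)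
    have "walk (S0 w) (xi w) (Suc t) $ e = walk (S0 w) (xi w) t $ e + xi w (Suc t) $ e" for t
      by (simp add: walk_def)
    then show ?case using elim by (auto simp: skip_free_def walk_def)
  qed
qed

lemma AE_skip_free0: "AE w in M. \<forall>K. skip_free (\<lambda>t. walk 0 (xi w) t $ e) K"
  using AE_step_le
proof eventually_elim
  case (elim w)
  have "walk 0 (xi w) (Suc t) $ e = walk 0 (xi w) t $ e + xi w (Suc t) $ e" for t
    by (simp add: walk_def)
  then show ?case using elim by (auto simp: skip_free_def walk_def)
qed

end

lemma skip_free_cong: "(\<And>t. t \<le> K \<Longrightarrow> g t = g' t) \<Longrightarrow> skip_free g K = skip_free g' K"
  unfolding skip_free_def by simp

section \<open>Splitting a path at a separating level\<close>

context constrained_walk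
begin

text \<open>At a separating level the walk splits into parts visiting disjoint sets of sites, except for the
  cut point itself, which the first part visits once and which costs nothing since \<open>H \<ge> 1\<close> there.\<close>

lemma prob_ev_path_split:
  assumes f: "first_at (\<lambda>t. y t $ e) (int k) j" and j: "j \<le> K"
    and ge: "\<And>t. j \<le> t \<Longrightarrow> t \<le> K \<Longrightarrow> int k \<le> y t $ e"
  shows "prob (ev_path y K) = prob (ev_path y j) * prob (ev_path0 (\<lambda>t. y (j + t) - y j) (K - j))"
proof -
  define z where "z = (\<lambda>t. y (j + t) - y j)"
  have yj: "y j $ e = int k" and lt: "\<And>t. t < j \<Longrightarrow> y t $ e < int k"
    using f by (auto simp: first_at_def)
  have low: "{i\<in>{..K}. y i = x} = {i\<in>{..j}. y i = x}" if "x $ e < int k" for x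
    using that ge j by (auto simp: not_less[symmetric])
  \<comment> \<open>Before \<open>j\<close> the path is strictly below level \<open>k\<close>, so
    all visits at or above that level belong to the remainder.\<close>
  have high: "{i\<in>{..K}. y i = y j + v} = (+) j ` {i\<in>{..K - j}. z i = v}" if "0 \<le> v $ e" for v
  proof (intro set_eqI iffI)
    fix i assume i: "i \<in> {i\<in>{..K}. y i = y j + v}"
    then have "\<not> i < j" using lt[of i] that yj by auto
    then show "i \<in> (+) j ` {i\<in>{..K - j}. z i = v}"
      using i by (intro image_eqI[of _ _ "i - j"]) (auto simp: z_def)
  qed (use j in \<open>auto simp: z_def\<close>)
  have lt_low: "local_time y K x = local_time y j x" if "x $ e < int k" for x
    unfolding local_time_eq_card low[OF that] ..
  have lt_high: "local_time y K (y j + v) = local_time z (K - j) v" if "0 \<le> v $ e" for v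
    unfolding local_time_eq_card high[OF that] by (rule card_image) (simp add: inj_on_def)
  have "{i\<in>{..j}. y i = y j} = {j}" using lt yj by (force simp: le_less)
  then have lt_j: "local_time y j (y j) = 1" unfolding local_time_eq_card by simp
  have im: "x \<in> y ` {..K} \<longleftrightarrow> x \<in> y ` {..j}" if "x $ e < int k" for x
    using low[OF that] by blast
  \<comment> \<open>Sites outside the half-space lie below level \<open>k \<ge> 0\<close>; the
    remainder does not visit them, so \<open>ev_start\<close> does not see it.\<close>
  have "y ` {..K} \<inter> {x. x $ e < 0} = y ` {..j} \<inter> {x. x $ e < 0}"
    using im by force
  then have start: "ev_start y K = ev_start y j"
    unfolding ev_start_def using lt_low by (intro Collect_cong conj_cong ball_cong refl) auto
  have steps: "(\<Prod>i\<in>{1..K}. step_prob (y i - y (i - 1)))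
     = (\<Prod>i\<in>{1..j}. step_prob (y i - y (i - 1))) * (\<Prod>i\<in>{1..K - j}. step_prob (z i - z (i - 1)))"
  proof -
    have "(\<Prod>i\<in>{1..j + (K - j)}. step_prob (y i - y (i - 1)))
       = (\<Prod>i\<in>{1..j}. step_prob (y i - y (i - 1))) * (\<Prod>i\<in>{j + 1..j + (K - j)}. step_prob (y i - y (i - 1)))"
      by (rule prod.ub_add_nat) simp
    also have "(\<Prod>i\<in>{j + 1..j + (K - j)}. step_prob (y i - y (i - 1)))
       = (\<Prod>i\<in>{1..K - j}. step_prob (z i - z (i - 1)))"
      by (rule prod.reindex_bij_witness[where i="\<lambda>i. i + j" and j="\<lambda>i. i - j"])
        (auto simp: z_def Suc_le_eq intro!: arg_cong[where f=step_prob])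
    finally show ?thesis using j by simp
  qed
  let ?P = "{x. 0 \<le> x $ e}" and ?L = "y ` {..K} \<inter> {x. 0 \<le> x $ e} \<inter> {x. x $ e < int k}"
  have half: "(\<Prod>x\<in>y ` {..K} \<inter> ?P. tail_prob (local_time y K x))
     = (\<Prod>x\<in>y ` {..j} \<inter> ?P. tail_prob (local_time y j x)) *
       (\<Prod>x\<in>z ` {..K - j} \<inter> ?P. tail_prob (local_time z (K - j) x))"
  proof -
    have "(\<Prod>x\<in>y ` {..K} \<inter> ?P. tail_prob (local_time y K x))
       = (\<Prod>x\<in>?L. tail_prob (local_time y K x)) *
         (\<Prod>x\<in>y ` {..K} \<inter> ?P - ?L. tail_prob (local_time y K x))"
      by (subst mult.commute, rule prod.subset_diff) auto
    also have "(\<Prod>x\<in>?L. tail_prob (local_time y K x)) = (\<Prod>x\<in>?L. tail_prob (local_time y j x))"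
      using lt_low by (intro prod.cong) auto
    \<comment> \<open>The cut point enters with its factor 1 to complete the sites of the first
      part; all its visits up to \<open>K\<close> are counted in the second product.\<close>
    also have "\<dots> = (\<Prod>x\<in>insert (y j) ?L. tail_prob (local_time y j x))"
      using yj by (subst prod.insert) (auto simp: lt_j tail_prob_1[simplified])
    also have "insert (y j) ?L = y ` {..j} \<inter> ?P"
    proof -
      have "x = y j" if "x \<in> y ` {..j}" "\<not> x $ e < int k" for x
        using that lt by (auto simp: le_less)
      note top = this
      have "x \<in> insert (y j) ?L \<longleftrightarrow> x \<in> y ` {..j} \<inter> ?P" for x
      proof (cases "x $ e < int k")
        case True
        moreover have "x \<noteq> y j" using yj True by auto
        ultimately show ?thesis using im[OF True] by blast
      next
        case False
        then have "x \<in> y ` {..j} \<longleftrightarrow> x = y j" using top by blast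
        then show ?thesis using False yj by simp
      qed
      then show ?thesis by (rule set_eqI)
    qed
    also have "y ` {..K} \<inter> ?P - ?L = (+) (y j) ` (z ` {..K - j} \<inter> ?P)"
    proof (intro set_eqI iffI)
      fix x assume x: "x \<in> y ` {..K} \<inter> ?P - ?L"
      then obtain i where i: "i \<le> K" "x = y i" "int k \<le> y i $ e" by auto
      then have "j \<le> i" using lt by (force simp: not_less[symmetric])
      then have "x = y j + z (i - j)" "0 \<le> z (i - j) $ e"
        using i yj by (simp_all add: z_def)
      moreover have "z (i - j) \<in> z ` {..K - j}" using i(1) by (intro imageI) auto
      ultimately show "x \<in> (+) (y j) ` (z ` {..K - j} \<inter> ?P)" by blast
    next
      fix x assume "x \<in> (+) (y j) ` (z ` {..K - j} \<inter> ?P)"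
      then obtain i where "i \<le> K - j" "x = y (j + i)" by (auto simp: z_def)
      then have "x \<in> y ` {..K}" "int k \<le> x $ e"
        using ge[of "j + i"] j by auto
      then show "x \<in> y ` {..K} \<inter> ?P - ?L" by auto
    qed
    also have "(\<Prod>x\<in>(+) (y j) ` (z ` {..K - j} \<inter> ?P). tail_prob (local_time y K x))
       = (\<Prod>x\<in>z ` {..K - j} \<inter> ?P. tail_prob (local_time y K (y j + x)))"
      by (subst prod.reindex) (auto simp: inj_on_def)
    also have "\<dots> = (\<Prod>x\<in>z ` {..K - j} \<inter> ?P. tail_prob (local_time z (K - j) x))"
      using lt_high by (intro prod.cong) auto
    finally show ?thesis .
  qed
  have "z 0 = 0" by (simp add: z_def)
  moreover have "0 \<le> z t $ e" if "t \<le> K - j" for t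
    using ge[of "j + t"] that j yj by (simp add: z_def)
  ultimately have "prob (ev_path0 z (K - j)) = (\<Prod>i\<in>{1..K - j}. step_prob (z i - z (i - 1))) *
       (\<Prod>x\<in>z ` {..K - j} \<inter> ?P. tail_prob (local_time z (K - j) x))"
    by (intro prob_ev_path0) auto
  then have "prob (ev_path y K) = prob (ev_path y j) * prob (ev_path0 z (K - j))"
    unfolding prob_ev_path start steps half by (simp add: mult_ac)
  then show ?thesis by (simp add: z_def)
qed

text \<open>For \<open>m = 0\<close> this is the event in the numerator of
  \<open>initial_law\<close>; general \<open>m\<close> is what the induction runs over. A function
  \<open>y\<close>, of which only the values up to \<open>K\<close> matter, makes prefixes and
  shifts simpler than a list would.\<close>

definition "path_event m n K y = {w\<in>space M. alpha e (walk (S0 w) (xi w)) n = enat K \<and>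
   enat K < T_star (walk (S0 w) (xi w)) (H w) \<and>
   eta e (walk (S0 w) (xi w)) (H w) n = int m \<and>
   map (walk (S0 w) (xi w)) [0..<K + 1] = map y [0..<K + 1]}"

text \<open>The event in the numerator of \<open>renewal_law\<close>, with \<open>P0\<close>
  unfolded.\<close>

definition "cycle_event l L z = {w\<in>space M. alpha e (walk 0 (xi w)) l = enat L \<and>
   enat L < T_star (walk 0 (xi w)) (half_space_constraint e (H w)) \<and>
   kappa e (walk 0 (xi w)) (half_space_constraint e (H w)) l = 0 \<and>
   map (\<lambda>j. walk 0 (xi w) j - walk 0 (xi w) 0) [1..<L + 1] = map z [1..<L + 1]}"

lemma map_upt_eq_iff: "map s [0..<K + 1] = map y [0..<K + 1] \<longleftrightarrow> (\<forall>t\<le>K. s t = y t)"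
  by (auto simp: list_eq_iff_nth_eq less_Suc_eq_le simp del: upt_Suc)

text \<open>Along \<open>y\<close> everything except survival is decided by \<open>y\<close> alone.
  No property of the steps enters, so this yields measurability for every \<open>y\<close>.\<close>

lemma path_event_eq:
  "path_event m n K y =
    (if alpha e y n = enat K \<and> card {k. separating e y n k} = Suc m then ev_path y K else {})"
proof -
  have "alpha e s n = enat K \<and> enat K < T_star s h \<and> eta e s h n = int m \<longleftrightarrow>
      (alpha e y n = enat K \<and> card {k. separating e y n k} = Suc m) \<and> enat K < T_star s h"
    if "\<forall>t\<le>K. s t = y t" for s h
  proof (cases "alpha e s n = enat K \<and> enat K < T_star s h")
    case True
    then have "separating e s n = separating e y n"
      using separating_cong[of K s y e n] that by auto
    moreover have "alpha e y n = enat K"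
      using True alpha_eq_cong[of K s y K e n] that by simp
    moreover have "event_B e s h n" using True by (simp add: event_B_def)
    ultimately show ?thesis using True by (auto simp: eta_def)
  next
    case False
    then show ?thesis using alpha_eq_cong[of K s y K e n] that by auto
  qed
  then show ?thesis
    unfolding path_event_def ev_path_def map_upt_eq_iff by auto
qed

lemma path_event_events [measurable]: "path_event m n K y \<in> events"
  unfolding path_event_eq by auto

lemma prob_ev_path_not_skip_free:
  assumes "\<not> skip_free (\<lambda>t. y t $ e) K"
  shows "prob (ev_path y K) = 0"
proof -
  have "AE w in M. w \<notin> ev_path y K"
    using AE_skip_free
  proof eventually_elim
    case (elim w)
    then have "skip_free (\<lambda>t. walk (S0 w) (xi w) t $ e) K" by blast
    moreover have "skip_free (\<lambda>t. walk (S0 w) (xi w) t $ e) K = skip_free (\<lambda>t. y t $ e) K"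
      if "w \<in> ev_path y K"
      using that by (intro skip_free_cong) (auto simp: ev_path_def)
    ultimately show ?case using assms by blast
  qed
  then show ?thesis using ev_path_events by (simp add: prob_eq_0)
qed

text \<open>The bound goes through the event that the walk follows \<open>z\<close>, which depends
  on the steps only and is measurable; so the set \<open>A\<close> itself may be arbitrary.\<close>

lemma prob_subset_ev_path0_not_skip_free:
  assumes "\<not> skip_free (\<lambda>t. z t $ e) K" and "A \<subseteq> ev_path0 z K"
  shows "prob A = 0"
proof -
  define N where "N = {w\<in>space M. \<forall>t\<le>K. walk 0 (xi w) t = z t}"
  have "N = (if z 0 = 0 then ev_steps z K else {})"
    unfolding N_def walk_eq_iff ev_steps_def by auto
  then have N: "N \<in> events" using ev_steps_sig sig_events by auto
  have "AE w in M. w \<notin> N"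
    using AE_skip_free0
  proof eventually_elim
    case (elim w)
    then have "skip_free (\<lambda>t. walk 0 (xi w) t $ e) K" by blast
    moreover have "skip_free (\<lambda>t. walk 0 (xi w) t $ e) K = skip_free (\<lambda>t. z t $ e) K"
      if "w \<in> N"
      using that by (intro skip_free_cong) (auto simp: N_def)
    ultimately show ?case using assms(1) by blast
  qed
  then have "prob N = 0" using N by (simp add: prob_eq_0)
  moreover have "prob A \<le> prob N"
    by (rule finite_measure_mono[OF _ N]) (use assms(2) in \<open>auto simp: N_def ev_path0_def\<close>)
  ultimately show ?thesis by (simp add: measure_le_0_iff)
qed

lemma prob_path_event:
  "prob (path_event m n K y) =
    (if skip_free (\<lambda>t. y t $ e) K \<and> first_at (\<lambda>t. y t $ e) (int n) K \<and>
        card (seps (\<lambda>t. y t $ e) K) = Suc m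
     then prob (ev_path y K) else 0)"
proof (cases "skip_free (\<lambda>t. y t $ e) K")
  case True
  have "{k. separating e y n k} = seps (\<lambda>t. y t $ e) K" if "first_at (\<lambda>t. y t $ e) (int n) K"
    using separating_iff_seps[OF True that] by auto
  then show ?thesis
    unfolding path_event_eq alpha_eq_iff_first_at[OF True] using True by auto
next
  case False
  then show ?thesis
    unfolding path_event_eq using prob_ev_path_not_skip_free by auto
qed

lemma prob_cycle_event:
  assumes "z 0 = 0"
  shows "prob (cycle_event l L z) =
    (if skip_free (\<lambda>t. z t $ e) L \<and> first_at (\<lambda>t. z t $ e) (int l) L \<and> 1 \<le> l \<and>
        seps (\<lambda>t. z t $ e) L = {0, l}
     then prob (ev_path0 z L) else 0)"
proof -
  let ?s = "\<lambda>w. walk 0 (xi w)" and ?h = "\<lambda>w. half_space_constraint e (H w)"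
  \<comment> \<open>The law lists displacements from time 1 on; since the walk and \<open>z\<close>
    both start at 0, this fixes the whole path.\<close>
  have eq: "map (\<lambda>j. ?s w j - ?s w 0) [1..<L + 1] = map z [1..<L + 1] \<longleftrightarrow> (\<forall>t\<le>L. ?s w t = z t)" for w
  proof -
    have "map (\<lambda>j. ?s w j - ?s w 0) [1..<L + 1] = map z [1..<L + 1] \<longleftrightarrow> (\<forall>t\<in>{1..L}. ?s w t = z t)"
      by (auto simp: walk_def simp del: upt_Suc)
    also have "\<dots> \<longleftrightarrow> (\<forall>t\<le>L. ?s w t = z t)"
      using assms by (auto simp: walk_def Suc_le_eq)
    finally show ?thesis .
  qed
  have sub: "cycle_event l L z \<subseteq> ev_path0 z L"
    unfolding cycle_event_def ev_path0_def eq by auto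
  show ?thesis
  proof (cases "skip_free (\<lambda>t. z t $ e) L")
    case True
    define D where "D \<longleftrightarrow> first_at (\<lambda>t. z t $ e) (int l) L \<and> 1 \<le> l \<and> seps (\<lambda>t. z t $ e) L = {0, l}"
    have "alpha e (?s w) l = enat L \<and> enat L < T_star (?s w) (?h w) \<and> kappa e (?s w) (?h w) l = 0 \<longleftrightarrow>
        D \<and> enat L < T_star (?s w) (?h w)"
      if w: "\<forall>t\<le>L. ?s w t = z t" for w
    proof -
      have sf: "skip_free (\<lambda>t. ?s w t $ e) L"
        using True w by (simp add: skip_free_def)
      have "first_at (\<lambda>t. ?s w t $ e) (int l) L \<longleftrightarrow> first_at (\<lambda>t. z t $ e) (int l) L"
        using w by (simp add: first_at_def)
      moreover have "seps (\<lambda>t. ?s w t $ e) L = seps (\<lambda>t. z t $ e) L"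
        using w by (simp add: first_at_def seps_def cong: conj_cong)
      ultimately show ?thesis
        unfolding D_def alpha_eq_iff_first_at[OF sf] using kappa_eq_0_iff_seps[OF sf] by auto
    qed
    then have "cycle_event l L z = (if D then ev_path0 z L else {})"
      unfolding cycle_event_def ev_path0_def eq by auto
    then show ?thesis using True unfolding D_def by simp
  next
    case False
    then show ?thesis
      using prob_subset_ev_path0_not_skip_free[OF False sub] by simp
  qed
qed

text \<open>Here \<open>l\<close> is the height and \<open>j\<close> the starting time of the last
  cycle. A path can be cut in at most one way, so at most one summand can differ from 0. The sum is
  kept because independence delivers the recursion for the blocks in this form.\<close>

lemma prob_path_event_Suc:
  "prob (path_event (Suc m) n K y) = (\<Sum>(l, j)\<in>{1..n} \<times> {..K}.
     prob (path_event m (n - l) j y) * prob (cycle_event l (K - j) (\<lambda>t. y (j + t) - y j)))"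
proof -
  let ?g = "\<lambda>t. y t $ e"
  let ?z = "\<lambda>j t. y (j + t) - y j" and ?gz = "\<lambda>j t. ?g (j + t) - ?g j"
  \<comment> \<open>The condition of \<open>prob_path_event\<close> for the prefix, joined with that
    of \<open>prob_cycle_event\<close> for the remainder.\<close>
  define good where "good l j \<longleftrightarrow>
    (skip_free ?g j \<and> first_at ?g (int (n - l)) j \<and> card (seps ?g j) = Suc m) \<and>
    (skip_free (?gz j) (K - j) \<and> first_at (?gz j) (int l) (K - j) \<and> 1 \<le> l \<and>
     seps (?gz j) (K - j) = {0, l})" for l j
  have good: "skip_free ?g K" "first_at ?g (int n) K" "seps ?g K = insert n (seps ?g j)"
      "n \<notin> seps ?g j" "card (seps ?g K) = Suc (Suc m)"
      "prob (ev_path y K) = prob (ev_path y j) * prob (ev_path0 (?z j) (K - j))"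
    if "good l j" "j \<le> K" "l \<in> {1..n}" for l j
  proof -
    have f: "first_at ?g (int (n - l)) j" and l: "1 \<le> l" and
      f': "first_at (?gz j) (int l) (K - j)" and s': "seps (?gz j) (K - j) = {0, l}" and
      c: "card (seps ?g j) = Suc m"
      using that(1) unfolding good_def by blast+
    have n: "n - l + l = n" using that(3) by simp
    show "skip_free ?g K"
      using skip_free_split[OF that(2), of ?g] that(1) unfolding good_def by blast
    show "first_at ?g (int n) K" and s: "seps ?g K = insert n (seps ?g j)"
      using seps_compose(1,2)[OF f that(2) l f' s'] n by simp_all
    show nin: "n \<notin> seps ?g j" using seps_le[OF f, of n] l that(3) by auto
    show "card (seps ?g K) = Suc (Suc m)"
      unfolding s using nin seps_finite[OF f] c by simp
    show "prob (ev_path y K) = prob (ev_path y j) * prob (ev_path0 (?z j) (K - j))"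
      by (rule prob_ev_path_split[OF f that(2) seps_compose(3)[OF f that(2) l f' s']])
  qed
  have summand: "prob (path_event m (n - l) j y) * prob (cycle_event l (K - j) (?z j)) =
      (if good l j then prob (ev_path y K) else 0)" if "j \<le> K" "l \<in> {1..n}" for l j
  proof -
    have "prob (path_event m (n - l) j y) * prob (cycle_event l (K - j) (?z j)) =
      (if good l j then prob (ev_path y j) * prob (ev_path0 (?z j) (K - j)) else 0)"
      unfolding good_def prob_path_event by (subst prob_cycle_event) auto
    then show ?thesis using good(6)[OF _ that] by auto
  qed
  have "(\<Sum>(l, j)\<in>{1..n} \<times> {..K}.
     prob (path_event m (n - l) j y) * prob (cycle_event l (K - j) (?z j))) =
     (\<Sum>p\<in>{1..n} \<times> {..K}. if good (fst p) (snd p) then prob (ev_path y K) else 0)"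
    using summand by (intro sum.cong) auto
  also have "\<dots> = prob (path_event (Suc m) n K y)"
  proof (cases "skip_free ?g K \<and> first_at ?g (int n) K \<and> card (seps ?g K) = Suc (Suc m)")
    case True
    then obtain j k where jk: "j \<le> K" "k < n" "first_at ?g (int k) j" "card (seps ?g j) = Suc m"
      "first_at (?gz j) (int (n - k)) (K - j)" "seps (?gz j) (K - j) = {0, n - k}"
      using seps_decompose[of ?g n K m] by blast
    then have g0: "good (n - k) j"
      using True skip_free_split[OF jk(1), of ?g] unfolding good_def by auto
    \<comment> \<open>Both prefixes have the separating levels of \<open>y\<close> without
      \<open>n\<close>. Hence their top levels agree, and with these the times of the first
      visit.\<close>
    have uniq: "l = n - k \<and> i = j" if "good l i" "i \<le> K" "l \<in> {1..n}" for l i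
    proof -
      have f: "first_at ?g (int (n - l)) i" using that(1) by (simp add: good_def)
      have "n - k \<in> {1..n}" using jk(2) by auto
      then have "seps ?g i = seps ?g j"
        using good(3,4)[OF that] good(3,4)[OF g0 jk(1)] by (metis insert_ident)
      then have "n - l = k"
        using seps_top[OF f] seps_le[OF f] seps_top[OF jk(3)] seps_le[OF jk(3)] by (metis le_antisym)
      then show ?thesis
        using first_at_unique[of ?g "int k" i j] f jk(3) that(3) by auto
    qed
    have "(\<Sum>p\<in>{1..n} \<times> {..K}. if good (fst p) (snd p) then prob (ev_path y K) else 0)
       = (\<Sum>p\<in>{(n - k, j)}. if good (fst p) (snd p) then prob (ev_path y K) else 0)"
    proof (rule sum.mono_neutral_right)
      show "\<forall>p\<in>{1..n} \<times> {..K} - {(n - k, j)}.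
          (if good (fst p) (snd p) then prob (ev_path y K) else 0) = 0"
        using uniq by force
    qed (use jk(1,2) in auto)
    then show ?thesis using g0 True by (simp add: prob_path_event)
  next
    case False
    have "\<not> good l j" if "l \<in> {1..n}" "j \<le> K" for l j
      using good(1,2,5)[OF _ that(2,1)] False by blast
    then show ?thesis using False unfolding prob_path_event by (intro trans[OF sum.neutral]) auto
  qed
  finally show ?thesis by simp
qed

text \<open>Starting at or below 0 with rises of at most one, the walk needs at least
  \<open>n\<close> steps to reach level \<open>n\<close>. Hence the guard \<open>k \<le> K\<close>
  in \<open>initial_law\<close> discards only null events.\<close>

lemma prob_path_event_le:
  assumes "K < n"
  shows "prob (path_event m n K y) = 0"
proof -
  have "n \<le> K" if "skip_free (\<lambda>t. y t $ e) K" "first_at (\<lambda>t. y t $ e) (int n) K"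
    using skip_free_le[OF that(1)] that(2) by (simp add: first_at_def)
  then show ?thesis using assms unfolding prob_path_event by auto
qed

end

subsection \<open>Concatenation of blocks\<close>

text \<open>Built from the blocks with index at most \<open>m\<close> alone, hence independent of
  the next block. The core sequence itself agrees with it only almost surely.\<close>

primrec core_path :: "(nat \<Rightarrow> 'd::finite block) \<Rightarrow> nat \<Rightarrow> (int ^ 'd) list" where
  "core_path b 0 = block_path b 0"
| "core_path b (Suc m) = core_path b m @ map ((+) (last (core_path b m))) (block_path b (Suc m))"

text \<open>The guards in \<open>initial_law\<close> and \<open>renewal_law\<close>; blocks
  violating them have mass 0.\<close>

definition valid_blocks :: "(nat \<Rightarrow> 'd block) \<Rightarrow> bool" where
  "valid_blocks b \<longleftrightarrow>
     fst (b 0) \<le> fst (snd (b 0)) \<and> length (snd (snd (b 0))) = fst (snd (b 0)) + 1 \<and>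
     (\<forall>i\<ge>1. 1 \<le> fst (b i) \<and> fst (b i) \<le> fst (snd (b i)) \<and> length (snd (snd (b i))) = fst (snd (b i)))"

lemma block_level_Suc: "block_level b (Suc m) = block_level b m + fst (b (Suc m))"
  by (simp add: block_level_def)

lemma block_time_Suc: "block_time b (Suc m) = block_time b m + fst (snd (b (Suc m)))"
  by (simp add: block_time_def)

text \<open>The counterpart for blocks of the fact that level \<open>n\<close> is not reached before
  time \<open>n\<close>: a path up to level \<open>n\<close> contains the positions at times
  \<open>0\<close> to \<open>n\<close>.\<close>

lemma block_level_le_block_time: "valid_blocks b \<Longrightarrow> block_level b m \<le> block_time b m"
  unfolding block_level_def block_time_def valid_blocks_def
  by (intro sum_mono) (metis One_nat_def Suc_leI not_gr_zero)

lemma block_level_strict_mono: "valid_blocks b \<Longrightarrow> strict_mono (block_level b)"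
  unfolding strict_mono_Suc_iff block_level_Suc valid_blocks_def
  by (metis One_nat_def Suc_leI Suc_le_lessD less_add_same_cancel1 zero_less_Suc)

lemma length_core_path: "valid_blocks b \<Longrightarrow> length (core_path b m) = block_time b m + 1"
  by (induction m) (auto simp: block_time_Suc block_time_def block_path_def valid_blocks_def)

lemma core_path_eq_core_sequence:
  assumes v: "valid_blocks b"
    and s0: "\<forall>j\<in>{0..block_time b 0}. s j = block_path b 0 ! j"
    and sS: "\<forall>i\<ge>1. \<forall>j\<in>{1..fst (snd (b i))}.
       s (block_time b (i - 1) + j) = s (block_time b (i - 1)) + block_path b i ! (j - 1)"
  shows "core_path b m = map s [0..<block_time b m + 1]"
proof (induction m)
  case 0
  show ?case
    using length_core_path[OF v, of 0] s0 by (auto intro!: nth_equalityI simp del: upt_Suc)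
next
  case (Suc m)
  let ?T = "block_time b m" and ?L = "fst (snd (b (Suc m)))"
  have "last (core_path b m) = s ?T" by (simp add: Suc)
  moreover have "map ((+) (s ?T)) (block_path b (Suc m)) = map s [?T + 1..<?T + 1 + ?L]"
  proof (rule nth_equalityI)
    show len: "length (map ((+) (s ?T)) (block_path b (Suc m))) = length (map s [?T + 1..<?T + 1 + ?L])"
      using v by (simp add: block_path_def valid_blocks_def)
    fix i assume i: "i < length (map ((+) (s ?T)) (block_path b (Suc m)))"
    then have "Suc i \<in> {1..?L}" using len by (simp del: upt_Suc)
    with sS[rule_format, of "Suc m" "Suc i"] have
      "s (?T + Suc i) = s ?T + block_path b (Suc m) ! i" by simp
    then show "map ((+) (s ?T)) (block_path b (Suc m)) ! i = map s [?T + 1..<?T + 1 + ?L] ! i"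
      using i len by (simp del: upt_Suc)
  qed
  moreover have "[0..<block_time b (Suc m) + 1] = [0..<?T + 1] @ [?T + 1..<?T + 1 + ?L]"
    using upt_add_eq_append[of 0 "?T + 1" ?L] by (simp add: block_time_Suc del: upt_Suc)
  ultimately show ?case by (simp only: core_path.simps Suc map_append)
qed

text \<open>Given the height \<open>l\<close> of the last block and its starting time
  \<open>j\<close>, the path dictates that block completely. The bounded quantifier lists the
  possible pairs \<open>(l, j)\<close>, matching the index set of
  \<open>prob_path_event_Suc\<close>.\<close>

lemma core_path_Suc_eq_iff:
  assumes v: "valid_blocks b"
  shows "block_level b (Suc m) = n \<and> core_path b (Suc m) = map y [0..<K + 1] \<longleftrightarrow>
    (\<exists>p\<in>{1..n} \<times> {..K}. block_level b m = n - fst p \<and> core_path b m = map y [0..<snd p + 1] \<and>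
       b (Suc m) = (fst p, K - snd p, map (\<lambda>t. y (snd p + t) - y (snd p)) [1..<K - snd p + 1]))"
proof -
  obtain l L xs where b: "b (Suc m) = (l, L, xs)" by (metis prod_cases3)
  have l: "1 \<le> l" and L: "length xs = L"
    using v b unfolding valid_blocks_def by (metis One_nat_def Suc_leI fst_conv snd_conv zero_less_Suc)+
  have path: "block_path b (Suc m) = xs" by (simp add: block_path_def b)
  define j where "j = block_time b m"
  have len: "length (core_path b m) = j + 1" using length_core_path[OF v] by (simp add: j_def)
  have shift: "map ((+) (y j)) (map (\<lambda>t. y (j + t) - y j) [1..<K - j + 1]) = map y [j + 1..<K + 1]"
    if "j \<le> K" using that by (intro nth_equalityI) (auto simp del: upt_Suc)
  have app: "map y [0..<K + 1] = map y [0..<j + 1] @ map y [j + 1..<K + 1]" if "j \<le> K"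
  proof -
    have "[0..<K + 1] = [0..<j + 1] @ [j + 1..<K + 1]"
      using upt_add_eq_append[of 0 "j + 1" "K - j"] that by simp
    then show ?thesis by (metis map_append)
  qed
  have core_path_iff: "core_path b (Suc m) = map y [0..<K + 1] \<longleftrightarrow>
     j \<le> K \<and> core_path b m = map y [0..<j + 1] \<and> xs = map (\<lambda>t. y (j + t) - y j) [1..<K - j + 1]"
  proof
    assume eq: "core_path b (Suc m) = map y [0..<K + 1]"
    have "length (core_path b (Suc m)) = K + 1" unfolding eq by simp
    \<comment> \<open>Comparing lengths identifies \<open>K\<close> as the end time of the last
      block; the two appended lists can then be compared piecewise.\<close>
    then have jK: "j + L = K" using len L by (simp add: path)
    then have "j \<le> K" by simp
    have "core_path b m @ map ((+) (last (core_path b m))) xs = map y [0..<j + 1] @ map y [j + 1..<K + 1]"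
      using eq app[OF \<open>j \<le> K\<close>] by (simp only: core_path.simps path)
    then have "core_path b m = map y [0..<j + 1] \<and> map ((+) (last (core_path b m))) xs = map y [j + 1..<K + 1]"
      by (rule append_eq_append_conv[THEN iffD1, rotated]) (simp add: len)
    then have 1: "core_path b m = map y [0..<j + 1]"
      and 2: "map ((+) (last (core_path b m))) xs = map y [j + 1..<K + 1]" by blast+
    have "last (core_path b m) = y j" unfolding 1 by simp
    with 2 have "map ((+) (y j)) xs = map ((+) (y j)) (map (\<lambda>t. y (j + t) - y j) [1..<K - j + 1])"
      unfolding shift[OF \<open>j \<le> K\<close>] by simp
    then have "xs = map (\<lambda>t. y (j + t) - y j) [1..<K - j + 1]"
      by (subst (asm) inj_map_eq_map) (auto simp: inj_def)
    with 1 \<open>j \<le> K\<close> show "j \<le> K \<and> core_path b m = map y [0..<j + 1] \<and>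
      xs = map (\<lambda>t. y (j + t) - y j) [1..<K - j + 1]" by blast
  next
    assume R: "j \<le> K \<and> core_path b m = map y [0..<j + 1] \<and> xs = map (\<lambda>t. y (j + t) - y j) [1..<K - j + 1]"
    then have "last (core_path b m) = y j" by simp
    then show "core_path b (Suc m) = map y [0..<K + 1]"
      using R shift app by (simp only: core_path.simps path)
  qed
  show ?thesis
  proof
    assume lhs: "block_level b (Suc m) = n \<and> core_path b (Suc m) = map y [0..<K + 1]"
    then have R: "j \<le> K" "core_path b m = map y [0..<j + 1]" "xs = map (\<lambda>t. y (j + t) - y j) [1..<K - j + 1]"
      using core_path_iff by blast+
    moreover have "L = K - j" using L R(3) by (auto simp del: upt_Suc)
    moreover have "block_level b m + l = n" using lhs by (simp add: block_level_Suc b)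
    ultimately show "\<exists>p\<in>{1..n} \<times> {..K}. block_level b m = n - fst p \<and> core_path b m = map y [0..<snd p + 1] \<and>
       b (Suc m) = (fst p, K - snd p, map (\<lambda>t. y (snd p + t) - y (snd p)) [1..<K - snd p + 1])"
      using l by (intro bexI[of _ "(l, j)"]) (auto simp: b simp del: upt_Suc)
  next
    assume "\<exists>p\<in>{1..n} \<times> {..K}. block_level b m = n - fst p \<and> core_path b m = map y [0..<snd p + 1] \<and>
       b (Suc m) = (fst p, K - snd p, map (\<lambda>t. y (snd p + t) - y (snd p)) [1..<K - snd p + 1])"
    then obtain i where i: "l \<in> {1..n}" "i \<le> K" "block_level b m = n - l" "core_path b m = map y [0..<i + 1]"
      "xs = map (\<lambda>t. y (i + t) - y i) [1..<K - i + 1]"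
      unfolding b by auto
    moreover have "i = j" using len unfolding i(4) by simp
    ultimately show "block_level b (Suc m) = n \<and> core_path b (Suc m) = map y [0..<K + 1]"
      using core_path_iff by (auto simp: block_level_Suc b)
  qed
qed

lemma block_level_cong: "(\<And>i. i \<le> m \<Longrightarrow> f i = g i) \<Longrightarrow> block_level f m = block_level g m"
  unfolding block_level_def by (intro sum.cong) auto

lemma core_path_cong: "(\<And>i. i \<le> m \<Longrightarrow> f i = g i) \<Longrightarrow> core_path f m = core_path g m"
  by (induction m) (auto simp: block_path_def)

section \<open>Independence of the next block from the path so far\<close>

context prob_space
begin

text \<open>The assumption on \<open>Q\<close> says that it depends only on the coordinates up to
  \<open>m\<close>. Since the values are countable, no measurability of \<open>Q\<close> has to be
  imposed.\<close>

lemma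
  fixes X :: "nat \<Rightarrow> 'a \<Rightarrow> 'b::countable"
  assumes indep: "indep_vars (\<lambda>_. count_space UNIV) X UNIV"
    and Q: "\<And>f g. (\<And>i. i \<le> m \<Longrightarrow> f i = g i) \<Longrightarrow> Q f = Q g"
  shows initial_event: "{v\<in>space M. Q (\<lambda>i. X i v)} \<in> events"
    and prob_initial_event_Int:
      "prob {v\<in>space M. Q (\<lambda>i. X i v) \<and> X (Suc m) v = b} =
       prob {v\<in>space M. Q (\<lambda>i. X i v)} * prob {v\<in>space M. X (Suc m) v = b}"
proof -
  let ?P = "PiM {..m} (\<lambda>_. count_space (UNIV :: 'b set))"
    and ?P' = "PiM {Suc m} (\<lambda>_. count_space (UNIV :: 'b set))"
  let ?R = "\<lambda>v. restrict (\<lambda>i. X i v) {..m}" and ?R' = "\<lambda>v. restrict (\<lambda>i. X i v) {Suc m}"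
  \<comment> \<open>Finite products of countable discrete spaces are discrete, so every subset is
    measurable.\<close>
  have P: "?P = count_space (PiE {..m} (\<lambda>_. UNIV))" "?P' = count_space (PiE {Suc m} (\<lambda>_. UNIV))"
    by (intro count_space_PiM_finite; simp)+
  have ind: "indep_var ?P ?R ?P' ?R'"
    using indep by (rule indep_var_restrict) auto
  have R: "?R \<in> M \<rightarrow>\<^sub>M ?P" using indep_var_rv1[OF ind] .
  have QR: "Q (\<lambda>i. X i v) \<longleftrightarrow> Q (?R v)" for v by (rule Q) simp
  define S where "S = {f \<in> PiE {..m} (\<lambda>_. UNIV). Q f}"
  define S' where "S' = {f \<in> PiE {Suc m} (\<lambda>_. UNIV). f (Suc m) = b}"
  have S: "S \<in> sets ?P" "S' \<in> sets ?P'" unfolding P S_def S'_def by auto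
  have 1: "{v\<in>space M. Q (\<lambda>i. X i v)} = ?R -` S \<inter> space M"
    unfolding QR S_def by auto
  then show "{v\<in>space M. Q (\<lambda>i. X i v)} \<in> events"
    using measurable_sets[OF R S(1)] by simp
  have 2: "{v\<in>space M. X (Suc m) v = b} = ?R' -` S' \<inter> space M"
    unfolding S'_def by auto
  have "{v\<in>space M. Q (\<lambda>i. X i v) \<and> X (Suc m) v = b} = (\<lambda>v. (?R v, ?R' v)) -` (S \<times> S') \<inter> space M"
    unfolding QR S_def S'_def by auto
  then show "prob {v\<in>space M. Q (\<lambda>i. X i v) \<and> X (Suc m) v = b} =
       prob {v\<in>space M. Q (\<lambda>i. X i v)} * prob {v\<in>space M. X (Suc m) v = b}"
    unfolding 1 2 using indep_varD[OF ind S] by simp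
qed

lemma prob_core_path_Suc:
  fixes blk :: "'a \<Rightarrow> nat \<Rightarrow> 'd::finite block"
  assumes indep: "indep_vars (\<lambda>_. count_space UNIV) (\<lambda>i v. blk v i) UNIV"
    and valid: "AE v in M. valid_blocks (blk v)"
  shows "prob {v\<in>space M. block_level (blk v) (Suc m) = n \<and> core_path (blk v) (Suc m) = map y [0..<K + 1]} =
    (\<Sum>(l, j)\<in>{1..n} \<times> {..K}.
       prob {v\<in>space M. block_level (blk v) m = n - l \<and> core_path (blk v) m = map y [0..<j + 1]} *
       prob {v\<in>space M. blk v (Suc m) = (l, K - j, map (\<lambda>t. y (j + t) - y j) [1..<K - j + 1])})"
proof -
  let ?Q = "\<lambda>p b. block_level b m = n - fst p \<and> core_path b m = map y [0..<snd p + 1]"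
  let ?b = "\<lambda>p. (fst p, K - snd p, map (\<lambda>t. y (snd p + t) - y (snd p)) [1..<K - snd p + 1])"
  have cong: "?Q p f = ?Q p g" if "\<And>i. i \<le> m \<Longrightarrow> f i = g i" for p and f g :: "nat \<Rightarrow> 'd block"
    using block_level_cong[of m f g] core_path_cong[of m f g] that by simp
  have "prob {v\<in>space M. block_level (blk v) (Suc m) = n \<and> core_path (blk v) (Suc m) = map y [0..<K + 1]} =
    (\<Sum>p\<in>{1..n} \<times> {..K}. prob {v\<in>space M. ?Q p (blk v) \<and> blk v (Suc m) = ?b p})"
  proof (rule prob_sum)
    show "{v\<in>space M. ?Q p (blk v) \<and> blk v (Suc m) = ?b p} \<in> events" for p
    proof (rule initial_event[OF indep, of "Suc m" "\<lambda>b. ?Q p b \<and> b (Suc m) = ?b p"])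
      show "(?Q p f \<and> f (Suc m) = ?b p) = (?Q p g \<and> g (Suc m) = ?b p)"
        if "\<And>i. i \<le> Suc m \<Longrightarrow> f i = g i" for f g
        using cong[of f g p] that by simp
    qed
    show "{v\<in>space M. block_level (blk v) (Suc m) = n \<and> core_path (blk v) (Suc m) = map y [0..<K + 1]} \<in> events"
    proof (rule initial_event[OF indep, of "Suc m"
          "\<lambda>b. block_level b (Suc m) = n \<and> core_path b (Suc m) = map y [0..<K + 1]"])
      show "(block_level f (Suc m) = n \<and> core_path f (Suc m) = map y [0..<K + 1]) =
            (block_level g (Suc m) = n \<and> core_path g (Suc m) = map y [0..<K + 1])"
        if "\<And>i. i \<le> Suc m \<Longrightarrow> f i = g i" for f g
        using block_level_cong[OF that] core_path_cong[OF that] by (simp only:)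
    qed
    show "AE v in M. (\<forall>p\<in>{1..n} \<times> {..K}. ?Q p (blk v) \<and> blk v (Suc m) = ?b p \<longrightarrow>
        block_level (blk v) (Suc m) = n \<and> core_path (blk v) (Suc m) = map y [0..<K + 1]) \<and>
      (block_level (blk v) (Suc m) = n \<and> core_path (blk v) (Suc m) = map y [0..<K + 1] \<longrightarrow>
        (\<exists>!p\<in>{1..n} \<times> {..K}. ?Q p (blk v) \<and> blk v (Suc m) = ?b p))"
      using valid
    proof eventually_elim
      case (elim v)
      \<comment> \<open>The last block records \<open>l\<close> and \<open>K - j\<close>, and
        \<open>j \<le> K\<close>; so it determines the pair, and the events summed over are
        disjoint.\<close>
      have uniq: "p = p'" if "p \<in> {1..n} \<times> {..K}" "p' \<in> {1..n} \<times> {..K}"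
        "blk v (Suc m) = ?b p" "blk v (Suc m) = ?b p'" for p p'
        using that by (auto simp: prod_eq_iff simp del: upt_Suc)
      show ?case
        unfolding core_path_Suc_eq_iff[OF elim] using uniq by (intro conjI ballI impI) blast+
    qed
  qed simp
  also have "\<dots> = (\<Sum>p\<in>{1..n} \<times> {..K}. prob {v\<in>space M. ?Q p (blk v)} * prob {v\<in>space M. blk v (Suc m) = ?b p})"
    using prob_initial_event_Int[OF indep, of m "?Q p" for p, OF cong] by (intro sum.cong refl) blast
  finally show ?thesis by (simp add: case_prod_beta)
qed

end

subsection \<open>Comparison with the core sequence\<close>

text \<open>The countable sum is taken with extended nonnegative values, where the constant can be
  pulled out without any summability argument.\<close>

lemma measure_UN_proportional:
  assumes "finite_measure M" "finite_measure N" and I: "countable I"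
    and E: "\<And>i. i \<in> I \<Longrightarrow> E i \<in> sets M" "disjoint_family_on E I"
    and F: "\<And>i. i \<in> I \<Longrightarrow> F i \<in> sets N" "disjoint_family_on F I"
    and eq: "\<And>i. i \<in> I \<Longrightarrow> measure M (E i) = c * measure N (F i)" and c: "0 \<le> c"
  shows "measure M (\<Union>i\<in>I. E i) = c * measure N (\<Union>i\<in>I. F i)"
proof -
  interpret M: finite_measure M by fact
  interpret N: finite_measure N by fact
  have "emeasure M (\<Union>i\<in>I. E i) = (\<integral>\<^sup>+i. emeasure M (E i) \<partial>count_space I)"
    using E I by (intro emeasure_UN_countable) auto
  also have "\<dots> = (\<integral>\<^sup>+i. ennreal c * emeasure N (F i) \<partial>count_space I)"
    using eq c by (intro nn_integral_cong) (simp add: M.emeasure_eq_measure N.emeasure_eq_measure ennreal_mult)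
  also have "\<dots> = ennreal c * (\<integral>\<^sup>+i. emeasure N (F i) \<partial>count_space I)"
    by (rule nn_integral_cmult) simp
  also have "(\<integral>\<^sup>+i. emeasure N (F i) \<partial>count_space I) = emeasure N (\<Union>i\<in>I. F i)"
    using F I by (intro emeasure_UN_countable[symmetric]) auto
  finally show ?thesis
    using c by (simp add: M.emeasure_eq_measure N.emeasure_eq_measure flip: ennreal_mult)
qed

lemma measurable_map_upt:
  fixes X :: "'w \<Rightarrow> nat \<Rightarrow> 'b::countable"
  assumes "\<And>t. (\<lambda>w. X w t) \<in> M \<rightarrow>\<^sub>M count_space UNIV"
  shows "(\<lambda>w. map (X w) [0..<n]) \<in> M \<rightarrow>\<^sub>M count_space UNIV"
  unfolding measurable_count_space_eq2_countable
proof (intro conjI ballI)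
  fix xs :: "'b list"
  have "(\<lambda>w. map (X w) [0..<n]) -` {xs} \<inter> space M =
     (if length xs = n then {w\<in>space M. \<forall>t\<in>{..<n}. X w t = xs ! t} else {})"
  proof -
    have "map (X w) [0..<n] = xs \<longleftrightarrow> length xs = n \<and> (\<forall>t\<in>{..<n}. X w t = xs ! t)" for w
      by (subst list_eq_iff_nth_eq) auto
    then show ?thesis by auto
  qed
  moreover have "{w\<in>space M. X w t = x} \<in> sets M" for t x
    using measurable_sets[OF assms, of "{x}" t] by (simp add: vimage_def Int_def conj_commute)
  then have "{w\<in>space M. \<forall>t\<in>{..<n}. X w t = xs ! t} \<in> sets M"
    by (intro sets.sets_Collect_finite_All) auto
  ultimately show "(\<lambda>w. map (X w) [0..<n]) -` {xs} \<inter> space M \<in> sets M" by simp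
qed auto

lemma map_upt_events:
  fixes X :: "'w \<Rightarrow> nat \<Rightarrow> 'b::countable"
  assumes "\<And>t. (\<lambda>w. X w t) \<in> M \<rightarrow>\<^sub>M count_space UNIV"
  shows "{w\<in>space M. map (X w) [0..<n] \<in> A} \<in> sets M"
  using measurable_sets[OF measurable_map_upt[OF assms], of A] by (simp add: vimage_def Int_def conj_commute)

lemma take_map_upt: "k \<le> n \<Longrightarrow> take k (map f [0..<n]) = map f [0..<k]"
  by (simp add: take_map)

section \<open>Events of the walk as countable unions over paths\<close>

context constrained_walk
begin

lemma event_B_E:
  assumes "event_B e s h n"
  obtains K where "alpha e s n = enat K" "enat K < T_star s h"
  using assms unfolding event_B_def by (cases "alpha e s n") auto

text \<open>The list is the trajectory up to the passage time, which is therefore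
  \<open>length ys - 1\<close>. The empty list is excluded because truncated subtraction would also
  give it the time 0.\<close>

lemma event_B_eq_path:
  "event_B e s h n \<longleftrightarrow> (\<exists>ys. ys \<noteq> [] \<and> alpha e s n = enat (length ys - 1) \<and>
     enat (length ys - 1) < T_star s h \<and> map s [0..<length ys] = ys)"
proof
  assume B: "event_B e s h n"
  then obtain K where K: "alpha e s n = enat K" "enat K < T_star s h"
    by (rule event_B_E)
  then show "\<exists>ys. ys \<noteq> [] \<and> alpha e s n = enat (length ys - 1) \<and>
     enat (length ys - 1) < T_star s h \<and> map s [0..<length ys] = ys"
    by (intro exI[of _ "map s [0..<K + 1]"]) (simp del: upt_Suc)
qed (auto simp: event_B_def)

text \<open>Lists over the lattice are countable, so measurability follows from that of the path
  events, without treating the two random times separately.\<close>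

lemma event_B_events: "{w\<in>space M. event_B e (walk (S0 w) (xi w)) (H w) n} \<in> events"
proof -
  define E where "E ys =
    (if alpha e (nth ys) n = enat (length ys - 1) then ev_path (nth ys) (length ys - 1) else {})" for ys
  have E: "w \<in> E ys \<longleftrightarrow> w \<in> space M \<and> alpha e (walk (S0 w) (xi w)) n = enat (length ys - 1) \<and>
       enat (length ys - 1) < T_star (walk (S0 w) (xi w)) (H w) \<and> map (walk (S0 w) (xi w)) [0..<length ys] = ys"
    if ys: "ys \<noteq> []" for ys w
  proof -
    obtain K where K: "length ys = K + 1" using ys by (cases ys) auto
    have "map (walk (S0 w) (xi w)) [0..<length ys] = ys \<longleftrightarrow> (\<forall>t\<le>K. walk (S0 w) (xi w) t = ys ! t)"
      using map_upt_eq_iff[of "walk (S0 w) (xi w)" K "nth ys"] map_nth[of ys] unfolding K by (simp only:)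
    moreover have "alpha e (walk (S0 w) (xi w)) n = enat K \<longleftrightarrow> alpha e (nth ys) n = enat K"
      if "\<forall>t\<le>K. walk (S0 w) (xi w) t = ys ! t"
      using alpha_eq_cong[of K "walk (S0 w) (xi w)" "nth ys" K e n] that by simp
    ultimately show ?thesis using K by (auto simp: ev_path_def E_def)
  qed
  have "{w\<in>space M. event_B e (walk (S0 w) (xi w)) (H w) n} = (\<Union>ys\<in>-{[]}. E ys)"
    unfolding event_B_eq_path using E by blast
  also have "\<dots> \<in> events"
    unfolding E_def by (intro sets.countable_UN') auto
  finally show ?thesis .
qed

lemma eta_eq_path:
  "{w\<in>space M. eta e (walk (S0 w) (xi w)) (H w) n = int m} =
   (\<Union>ys\<in>-{[]}. path_event m n (length ys - 1) (nth ys))"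
proof (intro set_eqI)
  fix w
  have "w \<in> path_event m n (length ys - 1) (nth ys) \<longleftrightarrow> w \<in> space M \<and>
       alpha e (walk (S0 w) (xi w)) n = enat (length ys - 1) \<and>
       enat (length ys - 1) < T_star (walk (S0 w) (xi w)) (H w) \<and>
       eta e (walk (S0 w) (xi w)) (H w) n = int m \<and> map (walk (S0 w) (xi w)) [0..<length ys] = ys"
    if "ys \<noteq> []" for ys
    using that map_nth[of ys] by (simp add: path_event_def)
  moreover have "event_B e (walk (S0 w) (xi w)) (H w) n"
    if "eta e (walk (S0 w) (xi w)) (H w) n = int m"
    using that by (auto simp: eta_def split: if_splits)
  ultimately show "w \<in> {w\<in>space M. eta e (walk (S0 w) (xi w)) (H w) n = int m} \<longleftrightarrow>
      w \<in> (\<Union>ys\<in>-{[]}. path_event m n (length ys - 1) (nth ys))"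
    unfolding event_B_eq_path by auto
qed

lemma eta_events: "{w\<in>space M. eta e (walk (S0 w) (xi w)) (H w) n = int m} \<in> events"
  unfolding eta_eq_path by (intro sets.countable_UN') auto

text \<open>Separating levels lie in \<open>{0..n}\<close> and include \<open>n\<close>, so there
  are between 1 and \<open>n + 1\<close> of them; this justifies summing over \<open>m\<close> from
  0 to \<open>n\<close>. The bound on the passage time ensures that the path up to it decides
  \<open>S\<close> at the times \<open>0\<close> to \<open>n\<close>. Applying
  \<open>the_enat\<close> is harmless, as the time is finite on this event.\<close>

lemma AE_event_B_eta:
  "AE w in M. (event_B e (walk (S0 w) (xi w)) (H w) n \<longrightarrow>
     n \<le> the_enat (alpha e (walk (S0 w) (xi w)) n) \<and>
     eta e (walk (S0 w) (xi w)) (H w) n \<in> {0..int n})"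
  using AE_skip_free
proof eventually_elim
  case (elim w)
  let ?s = "walk (S0 w) (xi w)"
  show ?case
  proof
    assume "event_B e ?s (H w) n"
    then obtain K where K: "alpha e ?s n = enat K" "enat K < T_star ?s (H w)"
      by (rule event_B_E)
    have sf: "skip_free (\<lambda>t. ?s t $ e) K" using elim by blast
    then have f: "first_at (\<lambda>t. ?s t $ e) (int n) K"
      using K(1) alpha_eq_iff_first_at by blast
    have "n \<le> K" using skip_free_le[OF sf] f by (simp add: first_at_def)
    moreover have "0 < card (seps (\<lambda>t. ?s t $ e) K)"
      using seps_top[OF f] seps_finite[OF f] by (auto simp: card_gt_0_iff)
    moreover have "card (seps (\<lambda>t. ?s t $ e) K) \<le> card {..n}"
      by (rule card_mono) (use seps_le[OF f] in auto)
    ultimately show "n \<le> the_enat (alpha e ?s n) \<and> eta e ?s (H w) n \<in> {0..int n}"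
      unfolding eta_eq_card_seps[OF sf f K(2)] K(1) by auto
  qed
qed

lemma eta_imp_event_B: "eta e s h n = int m \<Longrightarrow> event_B e s h n"
  by (auto simp: eta_def split: if_splits)

lemma prob_event_B_eq_sum:
  "prob {w\<in>space M. map (walk (S0 w) (xi w)) [0..<k + 1] \<in> A \<and> event_B e (walk (S0 w) (xi w)) (H w) n}
     = (\<Sum>m=0..n. prob {w\<in>space M. map (walk (S0 w) (xi w)) [0..<k + 1] \<in> A \<and>
                                eta e (walk (S0 w) (xi w)) (H w) n = int m})"
proof (rule prob_sum)
  have A: "{w\<in>space M. map (walk (S0 w) (xi w)) [0..<k + 1] \<in> A} \<in> events"
    by (rule map_upt_events) simp
  show "{w\<in>space M. map (walk (S0 w) (xi w)) [0..<k + 1] \<in> A \<and>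
      eta e (walk (S0 w) (xi w)) (H w) n = int m} \<in> events" for m
    by (rule sets.sets_Collect_conj[OF eta_events A])
  show "{w\<in>space M. map (walk (S0 w) (xi w)) [0..<k + 1] \<in> A \<and>
      event_B e (walk (S0 w) (xi w)) (H w) n} \<in> events"
    by (rule sets.sets_Collect_conj[OF event_B_events A])
  show "AE w in M. (\<forall>m\<in>{0..n}. map (walk (S0 w) (xi w)) [0..<k + 1] \<in> A \<and>
        eta e (walk (S0 w) (xi w)) (H w) n = int m \<longrightarrow>
      map (walk (S0 w) (xi w)) [0..<k + 1] \<in> A \<and> event_B e (walk (S0 w) (xi w)) (H w) n) \<and>
    (map (walk (S0 w) (xi w)) [0..<k + 1] \<in> A \<and> event_B e (walk (S0 w) (xi w)) (H w) n \<longrightarrow>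
      (\<exists>!m\<in>{0..n}. map (walk (S0 w) (xi w)) [0..<k + 1] \<in> A \<and>
        eta e (walk (S0 w) (xi w)) (H w) n = int m))"
    using AE_event_B_eta[of n]
  proof eventually_elim
    case (elim w)
    show ?case
    proof (intro conjI ballI impI)
      assume "map (walk (S0 w) (xi w)) [0..<k + 1] \<in> A \<and> event_B e (walk (S0 w) (xi w)) (H w) n"
      with elim obtain m where "m \<le> n" "eta e (walk (S0 w) (xi w)) (H w) n = int m"
        "map (walk (S0 w) (xi w)) [0..<k + 1] \<in> A"
        by (metis atLeastAtMost_iff nonneg_int_cases of_nat_le_iff)
      then show "\<exists>!m\<in>{0..n}. map (walk (S0 w) (xi w)) [0..<k + 1] \<in> A \<and>
        eta e (walk (S0 w) (xi w)) (H w) n = int m"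
        by (intro ex1I[of _ m]) auto
    qed (auto dest: eta_imp_event_B)
  qed
qed simp

lemma prob_cycle_event_le:
  assumes "z 0 = 0" "L < l"
  shows "prob (cycle_event l L z) = 0"
proof -
  have "l \<le> L" if "skip_free (\<lambda>t. z t $ e) L" "first_at (\<lambda>t. z t $ e) (int l) L"
    using skip_free_le[OF that(1)] that(2) by (simp add: first_at_def)
  then show ?thesis using assms by (auto simp: prob_cycle_event[of z, OF assms(1)])
qed

lemma renewal_law_eq:
  assumes "z 0 = 0" "1 \<le> l"
  shows "renewal_law M e xi H q (l, L, map z [1..<L + 1]) = prob (cycle_event l L z) / q ^ l"
  using assms prob_cycle_event_le[of z L l]
  by (simp add: renewal_law_def P0_def cycle_event_def del: upt_Suc)

lemma initial_law_eq:
  "initial_law M e S0 xi H q (n, K, map y [0..<K + 1]) =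
     prob (path_event 0 n K y) / (psi0 M e S0 xi H q * q ^ n)"
  using prob_path_event_le[of K n 0 y]
  by (simp add: initial_law_def path_event_def del: upt_Suc)

end

section \<open>Matching the walk with the core sequence\<close>

locale core_walk = constrained_walk M e S0 xi H + N: prob_space N
  for M :: "'w measure" and e :: "'d::finite" and S0 xi H and N :: "'v measure" +
  fixes q :: real and blk :: "'v \<Rightarrow> nat \<Rightarrow> 'd block" and Sbar :: "'v \<Rightarrow> nat \<Rightarrow> int ^ 'd"
  assumes q_pos: "0 < q" and core: "core_sequence M e S0 xi H q N blk Sbar"
begin

abbreviation "\<psi> \<equiv> psi0 M e S0 xi H q"

lemma blocks_indep: "N.indep_vars (\<lambda>_. count_space UNIV) (\<lambda>i v. blk v i) UNIV"
  using core unfolding core_sequence_def by blast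
lemma initial_block: "N.prob {v\<in>space N. blk v 0 = b} = initial_law M e S0 xi H q b"
  using core unfolding core_sequence_def by blast
lemma renewal_block: "1 \<le> i \<Longrightarrow> N.prob {v\<in>space N. blk v i = b} = renewal_law M e xi H q b"
  using core unfolding core_sequence_def by blast
lemma measurable_Sbar: "(\<lambda>v. Sbar v t) \<in> N \<rightarrow>\<^sub>M count_space UNIV"
  using core unfolding core_sequence_def by blast
lemma AE_core: "AE v in N.
        (\<forall>j\<in>{0..block_time (blk v) 0}. Sbar v j = block_path (blk v) 0 ! j) \<and>
        (\<forall>i\<ge>1. \<forall>j\<in>{1..fst (snd (blk v i))}.
           Sbar v (block_time (blk v) (i - 1) + j) = Sbar v (block_time (blk v) (i - 1)) + block_path (blk v) i ! (j - 1))"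
  using core unfolding core_sequence_def by blast

lemma measurable_blk: "(\<lambda>v. blk v i) \<in> N \<rightarrow>\<^sub>M count_space UNIV"
  using blocks_indep unfolding N.indep_vars_def by simp

lemma AE_block_neq:
  assumes "N.prob {v\<in>space N. blk v i = b} = 0"
  shows "AE v in N. blk v i \<noteq> b"
proof -
  have "{v\<in>space N. blk v i = b} \<in> N.events"
    using measurable_sets[OF measurable_blk, of "{b}" i] by (simp add: vimage_def Int_def conj_commute)
  then have "AE v in N. v \<notin> {v\<in>space N. blk v i = b}"
    using assms by (simp add: N.prob_eq_0)
  then show ?thesis by auto
qed

text \<open>There are only countably many blocks, so mass 0 for each misshapen one excludes all of
  them at once, for all indices.\<close>

lemma AE_valid_blocks: "AE v in N. valid_blocks (blk v)"
proof -
  have "AE v in N. \<forall>b. \<not> (fst b \<le> fst (snd b) \<and> length (snd (snd b)) = fst (snd b) + 1) \<longrightarrow> blk v 0 \<noteq> b"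
    unfolding AE_all_countable
  proof
    fix b
    show "AE v in N. \<not> (fst b \<le> fst (snd b) \<and> length (snd (snd b)) = fst (snd b) + 1) \<longrightarrow> blk v 0 \<noteq> b"
      by (cases "fst b \<le> fst (snd b) \<and> length (snd (snd b)) = fst (snd b) + 1")
        (auto intro!: AE_block_neq simp: initial_block initial_law_def split: prod.splits)
  qed
  moreover have "AE v in N. \<forall>i b. 1 \<le> i \<and>
      \<not> (1 \<le> fst b \<and> fst b \<le> fst (snd b) \<and> length (snd (snd b)) = fst (snd b)) \<longrightarrow> blk v i \<noteq> b"
    unfolding AE_all_countable
  proof (intro allI)
    fix i b
    show "AE v in N. 1 \<le> i \<and>
      \<not> (1 \<le> fst b \<and> fst b \<le> fst (snd b) \<and> length (snd (snd b)) = fst (snd b)) \<longrightarrow> blk v i \<noteq> b"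
    proof (cases "1 \<le> i \<and> \<not> (1 \<le> fst b \<and> fst b \<le> fst (snd b) \<and> length (snd (snd b)) = fst (snd b))")
      case True
      then have "N.prob {v\<in>space N. blk v i = b} = 0"
        by (subst renewal_block) (auto simp: renewal_law_def split: prod.splits)
      from AE_block_neq[OF this] show ?thesis by eventually_elim blast
    next
      case False
      then show ?thesis by (intro AE_I2) blast
    qed
  qed
  ultimately show ?thesis
    by eventually_elim (unfold valid_blocks_def, blast)
qed

lemma psi_nonneg: "0 \<le> \<psi>"
  unfolding psi0_def using q_pos by (intro infsum_nonneg) simp

text \<open>Division by 0 gives 0, so \<open>\<psi> = 0\<close> would make
  \<open>initial_law\<close> vanish on all of the countably many blocks, leaving no value for block
  0.\<close>

lemma psi_nonzero: "\<psi> \<noteq> 0"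
proof
  assume "\<psi> = 0"
  then have "N.prob {v\<in>space N. blk v 0 = b} = 0" for b
    unfolding initial_block by (simp add: initial_law_def split: prod.splits)
  then have "AE v in N. \<forall>b. blk v 0 \<noteq> b"
    unfolding AE_all_countable using AE_block_neq by blast
  then have "AE v in N. False" by eventually_elim blast
  then show False using N.AE_False by simp
qed

lemma level_path_events:
  "{v\<in>space N. block_level (blk v) m = n \<and> core_path (blk v) m = ys} \<in> N.events"
  by (rule N.initial_event[OF blocks_indep, of m "\<lambda>b. block_level b m = n \<and> core_path b m = ys"])
    (metis block_level_cong core_path_cong)

lemma level_events: "{v\<in>space N. block_level (blk v) m = n} \<in> N.events"
  by (rule N.initial_event[OF blocks_indep, of m "\<lambda>b. block_level b m = n"]) (metis block_level_cong)

text \<open>Both sides satisfy the same recursion in \<open>m\<close>. The hypothesis is used for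
  prefixes of \<open>y\<close> ending at lower levels, hence the generalization over
  \<open>n\<close> and \<open>K\<close>.\<close>

lemma prob_path_event_eq_core:
  "prob (path_event m n K y) = \<psi> * q ^ n *
     N.prob {v\<in>space N. block_level (blk v) m = n \<and> core_path (blk v) m = map y [0..<K + 1]}"
proof (induction m arbitrary: n K y)
  case 0
  have "N.prob {v\<in>space N. block_level (blk v) 0 = n \<and> core_path (blk v) 0 = map y [0..<K + 1]}
      = N.prob {v\<in>space N. blk v 0 = (n, K, map y [0..<K + 1])}"
  proof (rule N.finite_measure_eq_AE)
    show "AE v in N. v \<in> {v\<in>space N. block_level (blk v) 0 = n \<and> core_path (blk v) 0 = map y [0..<K + 1]} \<longleftrightarrow>
        v \<in> {v\<in>space N. blk v 0 = (n, K, map y [0..<K + 1])}"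
      using AE_valid_blocks
    proof eventually_elim
      case (elim v)
      \<comment> \<open>The path fixes only the list; the duration of the block is recovered from
        its length.\<close>
      have "fst (snd (blk v 0)) = K" if "snd (snd (blk v 0)) = map y [0..<K + 1]"
        using elim that unfolding valid_blocks_def by (metis add_right_cancel diff_zero length_map length_upt)
      then show ?case
        by (auto simp: block_level_def block_path_def prod_eq_iff simp del: upt_Suc)
    qed
    show "{v\<in>space N. blk v 0 = (n, K, map y [0..<K + 1])} \<in> N.events"
      using measurable_sets[OF measurable_blk, of "{(n, K, map y [0..<K + 1])}" 0]
      by (simp add: vimage_def Int_def conj_commute)
  qed (rule level_path_events)
  then show ?case
    unfolding initial_block initial_law_eq using psi_nonzero q_pos by simp
next
  case (Suc m)
  let ?z = "\<lambda>j t. y (j + t) - y j"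
  have "prob (path_event (Suc m) n K y) = (\<Sum>(l, j)\<in>{1..n} \<times> {..K}.
     prob (path_event m (n - l) j y) * prob (cycle_event l (K - j) (?z j)))"
    by (rule prob_path_event_Suc)
  also have "\<dots> = (\<Sum>(l, j)\<in>{1..n} \<times> {..K}. \<psi> * q ^ n *
     (N.prob {v\<in>space N. block_level (blk v) m = n - l \<and> core_path (blk v) m = map y [0..<j + 1]} *
      N.prob {v\<in>space N. blk v (Suc m) = (l, K - j, map (?z j) [1..<K - j + 1])}))"
  proof (intro sum.cong refl, clarify)
    fix l j assume "l \<in> {1..n}"
    \<comment> \<open>One factor is the weight of the prefix in the induction hypothesis, the other
      cancels the denominator of \<open>renewal_law\<close>.\<close>
    then have "q ^ n = q ^ (n - l) * q ^ l" "1 \<le> l" by (simp_all flip: power_add)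
    moreover have "renewal_law M e xi H q (l, K - j, map (?z j) [1..<K - j + 1])
        = prob (cycle_event l (K - j) (?z j)) / q ^ l"
      using \<open>1 \<le> l\<close> by (intro renewal_law_eq) auto
    ultimately show "prob (path_event m (n - l) j y) * prob (cycle_event l (K - j) (?z j)) =
      \<psi> * q ^ n *
     (N.prob {v\<in>space N. block_level (blk v) m = n - l \<and> core_path (blk v) m = map y [0..<j + 1]} *
      N.prob {v\<in>space N. blk v (Suc m) = (l, K - j, map (?z j) [1..<K - j + 1])})"
      using q_pos by (subst renewal_block) (simp_all add: Suc.IH del: upt_Suc)
  qed
  also have "\<dots> = \<psi> * q ^ n *
     N.prob {v\<in>space N. block_level (blk v) (Suc m) = n \<and> core_path (blk v) (Suc m) = map y [0..<K + 1]}"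
    unfolding N.prob_core_path_Suc[OF blocks_indep AE_valid_blocks]
    by (simp add: sum_distrib_left case_prod_beta)
  finally show ?case .
qed

lemma AE_core_prefix:
  "AE v in N. \<forall>m. core_path (blk v) m = map (Sbar v) [0..<block_time (blk v) m + 1]"
  using AE_core AE_valid_blocks
  by eventually_elim (auto simp: core_path_eq_core_sequence simp del: upt_Suc)

text \<open>Paths with different end times are compared through their common beginning: both sides
  are decomposed by the whole path up to the time when level \<open>n\<close> is reached. It has at
  least \<open>n + 1 \<ge> k + 1\<close> entries, so it decides whether the beginning lies in
  \<open>A\<close>.\<close>

lemma prob_prefix_eta:
  assumes "k \<le> n"
  shows "prob {w\<in>space M. map (walk (S0 w) (xi w)) [0..<k + 1] \<in> A \<and>
      eta e (walk (S0 w) (xi w)) (H w) n = int m}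
    = \<psi> * q ^ n * N.prob {v\<in>space N. map (Sbar v) [0..<k + 1] \<in> A \<and> block_level (blk v) m = n}"
proof -
  define Y where "Y = {ys. k + 1 \<le> length ys \<and> take (k + 1) ys \<in> A}"
  let ?E = "\<lambda>ys. path_event m n (length ys - 1) (nth ys)"
  let ?F = "\<lambda>ys. {v\<in>space N. block_level (blk v) m = n \<and> core_path (blk v) m = ys}"
  have ne: "length ys - 1 + 1 = length ys" if "ys \<in> Y" for ys
    using that by (cases ys) (auto simp: Y_def)
  have nth: "map (nth ys) [0..<length ys - 1 + 1] = ys" if "ys \<in> Y" for ys
    unfolding ne[OF that] by (rule map_nth)
  have E: "w \<in> ?E ys \<longleftrightarrow> w \<in> space M \<and> alpha e (walk (S0 w) (xi w)) n = enat (length ys - 1) \<and>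
      enat (length ys - 1) < T_star (walk (S0 w) (xi w)) (H w) \<and>
      eta e (walk (S0 w) (xi w)) (H w) n = int m \<and> map (walk (S0 w) (xi w)) [0..<length ys] = ys"
    if "ys \<in> Y" for ys w
    unfolding path_event_def nth[OF that] unfolding ne[OF that] by simp
  have "prob {w\<in>space M. map (walk (S0 w) (xi w)) [0..<k + 1] \<in> A \<and>
      eta e (walk (S0 w) (xi w)) (H w) n = int m} = prob (\<Union>ys\<in>Y. ?E ys)"
  proof (rule finite_measure_eq_AE)
    show "AE w in M. w \<in> {w\<in>space M. map (walk (S0 w) (xi w)) [0..<k + 1] \<in> A \<and>
      eta e (walk (S0 w) (xi w)) (H w) n = int m} \<longleftrightarrow> w \<in> (\<Union>ys\<in>Y. ?E ys)"
      using AE_event_B_eta[of n]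
    proof eventually_elim
      case (elim w)
      let ?s = "walk (S0 w) (xi w)"
      show ?case
      proof
        assume L: "w \<in> {w\<in>space M. map (walk (S0 w) (xi w)) [0..<k + 1] \<in> A \<and>
          eta e (walk (S0 w) (xi w)) (H w) n = int m}"
        then have B: "event_B e ?s (H w) n" by (auto dest: eta_imp_event_B)
        then obtain ys where ys: "ys \<noteq> []" "alpha e ?s n = enat (length ys - 1)"
          "enat (length ys - 1) < T_star ?s (H w)" "map ?s [0..<length ys] = ys"
          unfolding event_B_eq_path by blast
        have "k + 1 \<le> length ys" using elim B ys(1,2) assms by (cases ys) auto
        moreover from this have "take (k + 1) ys = map ?s [0..<k + 1]"
          using take_map_upt[of "k + 1" "length ys" ?s] ys(4) by simp
        ultimately have "ys \<in> Y" using L by (simp add: Y_def)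
        moreover have "w \<in> ?E ys" using E[OF \<open>ys \<in> Y\<close>] ys L by simp
        ultimately show "w \<in> (\<Union>ys\<in>Y. ?E ys)" by blast
      next
        assume "w \<in> (\<Union>ys\<in>Y. ?E ys)"
        then obtain ys where ys: "ys \<in> Y" "w \<in> ?E ys" by blast
        then have "k + 1 \<le> length ys" "take (k + 1) ys \<in> A" by (simp_all add: Y_def)
        then have "map ?s [0..<k + 1] \<in> A"
          using take_map_upt[of "k + 1" "length ys" ?s] ys E[OF ys(1)] by simp
        then show "w \<in> {w\<in>space M. map (walk (S0 w) (xi w)) [0..<k + 1] \<in> A \<and>
          eta e (walk (S0 w) (xi w)) (H w) n = int m}"
          using ys E[OF ys(1)] by simp
      qed
    qed
    show "{w\<in>space M. map (walk (S0 w) (xi w)) [0..<k + 1] \<in> A \<and>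
      eta e (walk (S0 w) (xi w)) (H w) n = int m} \<in> events"
      by (intro sets.sets_Collect_conj eta_events map_upt_events measurable_walk)
    show "(\<Union>ys\<in>Y. ?E ys) \<in> events" by (intro sets.countable_UN') auto
  qed
  also have "\<dots> = \<psi> * q ^ n * N.prob (\<Union>ys\<in>Y. ?F ys)"
  proof (rule measure_UN_proportional)
    show "disjoint_family_on ?E Y"
      unfolding disjoint_family_on_def
    proof (intro ballI impI)
      fix ys zs assume *: "ys \<in> Y" "zs \<in> Y" "ys \<noteq> zs"
      \<comment> \<open>The passage time fixes the common length, and both lists are then the
        trajectory up to that time.\<close>
      have False if "w \<in> ?E ys" "w \<in> ?E zs" for w
        using that * ne[OF *(1)] ne[OF *(2)] unfolding E[OF *(1)] E[OF *(2)]
        by (metis enat.inject)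
      then show "?E ys \<inter> ?E zs = {}" by blast
    qed
    show "disjoint_family_on ?F Y"
      unfolding disjoint_family_on_def by auto
    show "prob (?E ys) = \<psi> * q ^ n * N.prob (?F ys)" if "ys \<in> Y" for ys
      using prob_path_event_eq_core[of m n "length ys - 1" "nth ys"] unfolding nth[OF that] .
  qed (use psi_nonneg q_pos level_path_events in \<open>auto intro: finite_measure_axioms N.finite_measure_axioms\<close>)
  also have "N.prob (\<Union>ys\<in>Y. ?F ys)
    = N.prob {v\<in>space N. map (Sbar v) [0..<k + 1] \<in> A \<and> block_level (blk v) m = n}"
  proof (rule N.finite_measure_eq_AE)
    show "AE v in N. v \<in> (\<Union>ys\<in>Y. ?F ys) \<longleftrightarrow>
       v \<in> {v\<in>space N. map (Sbar v) [0..<k + 1] \<in> A \<and> block_level (blk v) m = n}"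
      using AE_core_prefix AE_valid_blocks
    proof eventually_elim
      case (elim v)
      let ?T = "block_time (blk v) m"
      have "v \<in> (\<Union>ys\<in>Y. ?F ys) \<longleftrightarrow> v \<in> space N \<and> block_level (blk v) m = n \<and> core_path (blk v) m \<in> Y"
        by auto
      also have "\<dots> \<longleftrightarrow> v \<in> {v\<in>space N. map (Sbar v) [0..<k + 1] \<in> A \<and> block_level (blk v) m = n}"
      proof -
        have "core_path (blk v) m \<in> Y \<longleftrightarrow> map (Sbar v) [0..<k + 1] \<in> A" if "block_level (blk v) m = n"
        proof -
          have "k \<le> ?T" using block_level_le_block_time[OF elim(2), of m] that assms by simp
          then show ?thesis
            using elim(1) take_map_upt[of "k + 1" "?T + 1" "Sbar v"] by (simp add: Y_def del: upt_Suc)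
        qed
        then show ?thesis by auto
      qed
      finally show ?case .
    qed
    show "(\<Union>ys\<in>Y. ?F ys) \<in> N.events"
      using level_path_events by (intro sets.countable_UN') auto
    show "{v\<in>space N. map (Sbar v) [0..<k + 1] \<in> A \<and> block_level (blk v) m = n} \<in> N.events"
      by (intro sets.sets_Collect_conj level_events map_upt_events measurable_Sbar)
  qed
  finally show ?thesis .
qed

text \<open>Valid blocks with positive index climb at least one level, so level \<open>n\<close> is
  reached for at most one \<open>m\<close> and the events are almost surely disjoint.\<close>

lemma prob_event_Bbar_eq_sum:
  "N.prob {v\<in>space N. map (Sbar v) [0..<k + 1] \<in> A \<and> event_Bbar (blk v) n} =
    (\<Sum>m=0..n. N.prob {v\<in>space N. map (Sbar v) [0..<k + 1] \<in> A \<and> block_level (blk v) m = n})"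
proof (rule N.prob_sum)
  have A: "{v\<in>space N. map (Sbar v) [0..<k + 1] \<in> A} \<in> N.events"
    by (intro map_upt_events measurable_Sbar)
  then show "{v\<in>space N. map (Sbar v) [0..<k + 1] \<in> A \<and> block_level (blk v) m = n} \<in> N.events" for m
    by (intro sets.sets_Collect_conj level_events)
  show "{v\<in>space N. map (Sbar v) [0..<k + 1] \<in> A \<and> event_Bbar (blk v) n} \<in> N.events"
    unfolding event_Bbar_def using A level_events
    by (intro sets.sets_Collect_conj sets.sets_Collect_finite_Ex) auto
  show "AE v in N. (\<forall>m\<in>{0..n}. map (Sbar v) [0..<k + 1] \<in> A \<and> block_level (blk v) m = n \<longrightarrow>
      map (Sbar v) [0..<k + 1] \<in> A \<and> event_Bbar (blk v) n) \<and>
    (map (Sbar v) [0..<k + 1] \<in> A \<and> event_Bbar (blk v) n \<longrightarrow>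
      (\<exists>!m\<in>{0..n}. map (Sbar v) [0..<k + 1] \<in> A \<and> block_level (blk v) m = n))"
    using AE_valid_blocks
  proof eventually_elim
    case (elim v)
    have "i = j" if "block_level (blk v) i = n" "block_level (blk v) j = n" for i j
      using strict_mono_eq[OF block_level_strict_mono[OF elim]] that by metis
    then show ?case unfolding event_Bbar_def by blast
  qed
qed simp

lemma prob_prefix_event_B:
  assumes "k \<le> n"
  shows "prob {w\<in>space M. map (walk (S0 w) (xi w)) [0..<k + 1] \<in> A \<and>
      event_B e (walk (S0 w) (xi w)) (H w) n}
    = \<psi> * q ^ n * N.prob {v\<in>space N. map (Sbar v) [0..<k + 1] \<in> A \<and> event_Bbar (blk v) n}"
  unfolding prob_event_B_eq_sum prob_event_Bbar_eq_sum prob_prefix_eta[OF assms]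
  by (simp add: sum_distrib_left)

lemma prob_event_B:
  "prob {w\<in>space M. event_B e (walk (S0 w) (xi w)) (H w) n}
    = \<psi> * q ^ n * N.prob {v\<in>space N. event_Bbar (blk v) n}"
  using prob_prefix_event_B[of 0 n UNIV] by simp

text \<open>The factor \<open>\<psi> * q ^ n\<close> is nonzero and cancels. If the conditioning
  events are null, both quotients are 0 by the convention for division by 0.\<close>

lemma cond_prob_prefix:
  assumes "k \<le> n"
  shows "\<P>(w in M. map (walk (S0 w) (xi w)) [0..<k + 1] \<in> A \<bar> event_B e (walk (S0 w) (xi w)) (H w) n)
       = \<P>(v in N. map (Sbar v) [0..<k + 1] \<in> A \<bar> event_Bbar (blk v) n)"
  unfolding cond_prob_def prob_prefix_event_B[OF assms] prob_event_B
  using psi_nonzero q_pos by simp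

end

theorem corollary1:
  fixes M :: "'w measure" and N :: "'v measure"
    and e :: "'d::finite"
    and S0 :: "'w \<Rightarrow> int ^ 'd"
    and xi :: "'w \<Rightarrow> nat \<Rightarrow> int ^ 'd"
    and H :: "'w \<Rightarrow> int ^ 'd \<Rightarrow> enat"
    and q :: real
    and blk :: "'v \<Rightarrow> nat \<Rightarrow> 'd block"
    and Sbar :: "'v \<Rightarrow> nat \<Rightarrow> int ^ 'd"
  assumes "prob_space M"
    and "A1 M e xi" and "A2 M e S0 xi H" and "A3 M e H" and "A4 M e xi H"
    and "is_q M e xi H q"
    and "prob_space N"
    and "core_sequence M e S0 xi H q N blk Sbar"
  shows "(\<forall>n. \<P>(w in M. event_B e (walk (S0 w) (xi w)) (H w) n)
              = psi0 M e S0 xi H q * q ^ n * \<P>(v in N. event_Bbar (blk v) n)) \<and>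
    (\<forall>n k A. k \<le> n \<longrightarrow> A \<subseteq> {xs. length xs = k + 1} \<longrightarrow>
       \<P>(w in M. map (walk (S0 w) (xi w)) [0..<k + 1] \<in> A \<and> event_B e (walk (S0 w) (xi w)) (H w) n)
         = (\<Sum>m=0..n. \<P>(w in M. map (walk (S0 w) (xi w)) [0..<k + 1] \<in> A \<and>
                                eta e (walk (S0 w) (xi w)) (H w) n = int m)) \<and>
       (\<Sum>m=0..n. \<P>(w in M. map (walk (S0 w) (xi w)) [0..<k + 1] \<in> A \<and>
                              eta e (walk (S0 w) (xi w)) (H w) n = int m))
         = (\<Sum>m=0..n. psi0 M e S0 xi H q * q ^ n *
                       \<P>(v in N. map (Sbar v) [0..<k + 1] \<in> A \<and> block_level (blk v) m = n)) \<and>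
       (\<Sum>m=0..n. psi0 M e S0 xi H q * q ^ n *
                     \<P>(v in N. map (Sbar v) [0..<k + 1] \<in> A \<and> block_level (blk v) m = n))
         = psi0 M e S0 xi H q * q ^ n * \<P>(v in N. map (Sbar v) [0..<k + 1] \<in> A \<and> event_Bbar (blk v) n) \<and>
       \<P>(w in M. map (walk (S0 w) (xi w)) [0..<k + 1] \<in> A \<bar> event_B e (walk (S0 w) (xi w)) (H w) n)
         = \<P>(v in N. map (Sbar v) [0..<k + 1] \<in> A \<bar> event_Bbar (blk v) n))"
proof -
  interpret M: prob_space M by fact
  interpret N: prob_space N by fact
  interpret core_walk M e S0 xi H N q blk Sbar
    by unfold_locales (use assms in \<open>auto simp: is_q_def\<close>)
  show ?thesis
    by (intro conjI allI impI prob_event_B prob_event_B_eq_sum sum.cong refl prob_prefix_eta cond_prob_prefix)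
      (auto simp only: prob_event_Bbar_eq_sum sum_distrib_left)
qed

end
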